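(* Fix an integer $t\geq 2$ and let $r_1,r_2,\dots,r_t$ be positive integers. If $n\geq R(r_1K_2,\dots,r_tK_2)$, then $$\widetilde{R}(r_1K_2,\dots,r_tK_2;n)\leq \frac{2t-1+(t-3)\lg(t-2)}{t+1}\,n .$$
   Context: $rK_2$ denotes the matching with $r$ edges (i.e. $r$ pairwise disjoint edges). $\lg=\log_2$, with the convention $\lg 0=0$. Ramsey number: $R(G_1,\dots,G_t)$ is the least integer $n$ such that any $t$-coloring $E(K_n)\to[t]=\{1,\dots,t\}$ contains a copy of $G_i$ all of whose edges have color $i$, for some $i\in[t]$. Restricted online Ramsey number: let $n\ge R(G_1,\dots,G_t)$. Painter first picks a coloring $\chi:E(K_n)\to[t]$, hidden from Builder. In each round Builder points to (queries) an edge of $K_n$, chosen depending on the answers so far, and Painter reveals the color of that edge; queried edges are called exposed. Builder wins once, for some $i\in[t]$, the exposed edges of color $i$ contain a copy of $G_i$. $\widetilde{R}(G_1,\dots,G_t;n)$ is the least integer $\ell$ for which Builder has a strategy guaranteeing a win with at most $\ell$ queries, regardless of Painter's coloring/strategy. *)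

theory Defs
  imports Complex_Main "HOL-Library.Ramsey"
begin

text \<open>A graph is a pair of a vertex set and a set of two-element edges. \<open>K\<^sub>n\<close> has
  vertex set \<open>{..<n}\<close>, and its edge set is \<open>nsets {..<n} 2\<close>.\<close>

type_synonym 'a graph = "'a set \<times> 'a set set"

definition complete_graph :: "nat \<Rightarrow> nat graph" where
  "complete_graph n = ({..<n}, nsets {..<n} 2)"

definition matching_graph :: "nat \<Rightarrow> nat graph" where
  "matching_graph r = ({..<2 * r}, {{2 * i, 2 * i + 1} | i. i < r})"

text \<open>Copies are subgraphs that need not be induced.\<close>

definition contains_copy :: "'b graph \<Rightarrow> 'a graph \<Rightarrow> bool" where
  "contains_copy H G \<longleftrightarrow>
     (\<exists>f. inj_on f (fst G) \<and> f ` fst G \<subseteq> fst H \<and> (\<forall>e\<in>snd G. f ` e \<in> snd H))"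

text \<open>Colors are \<open>1, \<dots>, t\<close>; a coloring is unconstrained outside the edge set, where its
  values are never used.\<close>

definition edge_colorings :: "nat \<Rightarrow> nat \<Rightarrow> (nat set \<Rightarrow> nat) set" where
  "edge_colorings t n = snd (complete_graph n) \<rightarrow> {1..t}"

definition ramsey_number :: "nat \<Rightarrow> (nat \<Rightarrow> 'a graph) \<Rightarrow> nat" where
  "ramsey_number t G =
     (LEAST n. \<forall>\<chi>\<in>edge_colorings t n. \<exists>i\<in>{1..t}.
        contains_copy ({..<n}, {e \<in> snd (complete_graph n). \<chi> e = i}) (G i))"

text \<open>A history lists the exposed edges with the revealed colors, in the order of the queries.
  A strategy of Builder maps a history to the next query. Querying an edge again is allowed
  but counts as a round.\<close>

type_synonym history = "(nat set \<times> nat) list"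

type_synonym strategy = "history \<Rightarrow> nat set"

primrec play :: "strategy \<Rightarrow> (nat set \<Rightarrow> nat) \<Rightarrow> nat \<Rightarrow> history" where
  "play \<sigma> \<chi> 0 = []"
| "play \<sigma> \<chi> (Suc k) =
     (let e = \<sigma> (play \<sigma> \<chi> k) in play \<sigma> \<chi> k @ [(e, \<chi> e)])"

definition builder_wins :: "nat \<Rightarrow> (nat \<Rightarrow> 'a graph) \<Rightarrow> nat \<Rightarrow> history \<Rightarrow> bool" where
  "builder_wins t G n h \<longleftrightarrow>
     (\<exists>i\<in>{1..t}. contains_copy ({..<n}, {e. (e, i) \<in> set h}) (G i))"

text \<open>Queries need only be edges of \<open>K\<^sub>n\<close> in the rounds played before the game ends.\<close>

definition winning_strategy ::
    "nat \<Rightarrow> (nat \<Rightarrow> 'a graph) \<Rightarrow> nat \<Rightarrow> nat \<Rightarrow> strategy \<Rightarrow> bool" where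
  "winning_strategy t G n l \<sigma> \<longleftrightarrow>
     (\<forall>\<chi>\<in>edge_colorings t n. \<exists>k\<le>l.
        (\<forall>j<k. \<sigma> (play \<sigma> \<chi> j) \<in> snd (complete_graph n)) \<and>
        builder_wins t G n (play \<sigma> \<chi> k))"

definition restricted_online_ramsey :: "nat \<Rightarrow> (nat \<Rightarrow> 'a graph) \<Rightarrow> nat \<Rightarrow> nat" where
  "restricted_online_ramsey t G n = (LEAST l. \<exists>\<sigma>. winning_strategy t G n l \<sigma>)"

definition lg :: "real \<Rightarrow> real" where
  "lg x = (if x = 0 then 0 else log 2 x)"

end

theory Submission
  imports Defs "HOL-Library.Log_Nat" "HOL-Library.Disjoint_Sets"
begin

text \<open>
  Write \<open>a\<^sub>i\<close> for the size of a matching exposed in color \<open>i\<close>. The colorings that show the lower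
  bound of Cockayne and Lorimer (\<open>matching_avoiding_coloring\<close>) give
  \<open>n > \<Sum>\<^sub>i (r\<^sub>i - 1) + r\<^sub>j\<close> for every color \<open>j\<close>. Hence Builder has won as soon as
  \<open>\<Sum>\<^sub>i a\<^sub>i + a\<^sub>j \<ge> n - 1\<close> for some \<open>j\<close>. Vertex-disjoint exposed trees certify
  this if each is properly edge-colored, they all contain one common color \<open>j\<close>, and they miss at
  most one vertex: a color class of a properly colored tree is a matching, so summing over the colors
  counts all edges, that is all covered vertices minus the number of trees, and \<open>a\<^sub>j\<close> is at least the
  number of trees (\<open>arrangement_wins\<close>).

  Builder therefore keeps such a family of trees with a common color and queries a pair \<open>xy\<close> of
  uncovered vertices. If its color \<open>c\<close> occurs in all trees, then \<open>xy\<close> becomes a new tree and \<open>c\<close> is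
  the common color from now on. Otherwise \<open>c\<close> is missing in some tree \<open>T\<close>, and Builder queries edges from
  \<open>T\<close> to \<open>{x, y}\<close> until \<open>T\<close> can be turned into a properly colored tree with one more color and
  all the old ones; the common color survives. In both cases the number of colors, summed over the
  trees, increases, so this ends.

  The merging step (\<open>piece_search\<close>) is a binary search. Suppose that the edge from \<open>u \<in> T\<close> to \<open>x\<close> has
  color \<open>i\<close>. If \<open>i\<close> is new to \<open>T\<close>, the edge extends \<open>T\<close>. If \<open>i\<close> occurs in \<open>T\<close>, but
  not at \<open>u\<close>, then \<open>T\<close> can absorb both \<open>ux\<close> and \<open>xy\<close>. If \<open>i\<close> is the color of an edge
  \<open>uv\<close> and \<open>v\<close> is a leaf, then \<open>v\<close> is given up in exchange for \<open>x\<close> and \<open>y\<close>. In the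
  remaining case, \<open>u\<close> points to \<open>v\<close>. Every inner vertex then points to a neighbor, so that somewhere
  two adjacent vertices \<open>u\<close> and \<open>v\<close> point to each other; if one of them was joined to \<open>x\<close> and the
  other one to \<open>y\<close>, which a 2-coloring of \<open>T\<close> ensures, then the edge \<open>uv\<close> can be replaced by the
  path \<open>u, x, y, v\<close>. Following the arrows from centroid to centroid (\<open>tree_centroid\<close>) halves the number
  of inner vertices each time, so at most \<open>1 + \<lfloor>lg (e - 1)\<rfloor>\<close> queries suffice if \<open>T\<close> has \<open>e \<ge> 2\<close> edges.

  A tree that grew one edge at a time up to \<open>s\<close> edges with \<open>s\<close> colors has thus cost at most
  \<open>1 + 2 + \<Sum>\<^sub>e (2 + lg (e - 1))\<close> queries with \<open>e\<close> from \<open>2\<close> to \<open>s - 1\<close>, which is at most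
  \<open>2s - 1 + (s - 3) lg (s - 2)\<close>; per vertex this is the claimed rate for \<open>s\<close> in place of \<open>t\<close>, and the rate
  increases with \<open>s\<close>. Steps that absorb two vertices at once cost less than two single steps, and the
  amount saved pays for the longer searches in the larger tree (\<open>tree_cost_le_rate\<close>).
\<close>

section \<open>Trees and their centroids\<close>

inductive tree :: "'a set \<Rightarrow> 'a set set \<Rightarrow> bool" where
  single: "tree {v} {}"
| pendant: "tree V A \<Longrightarrow> u \<in> V \<Longrightarrow> x \<notin> V \<Longrightarrow> tree (insert x V) (insert {u, x} A)"

lemma tree_basics:
  assumes "tree V A"
  shows "finite V" "V \<noteq> {}" "finite A" "\<And>e. e \<in> A \<Longrightarrow> e \<subseteq> V \<and> card e = 2" "Suc (card A) = card V"
proof -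
  have "finite V \<and> V \<noteq> {} \<and> finite A \<and> (\<forall>e\<in>A. e \<subseteq> V \<and> card e = 2) \<and> Suc (card A) = card V"
    using assms
  proof induction
    case (single v)
    then show ?case by simp
  next
    case (pendant V A u x)
    then have "{u, x} \<notin> A" "u \<noteq> x" by auto
    with pendant show ?case by auto
  qed
  then show "finite V" "V \<noteq> {}" "finite A" "\<And>e. e \<in> A \<Longrightarrow> e \<subseteq> V \<and> card e = 2" "Suc (card A) = card V"
    by auto
qed

lemma tree_edge:
  assumes "tree V A" "{u, v} \<in> A"
  shows "u \<in> V" "v \<in> V" "u \<noteq> v"
proof -
  have *: "{u, v} \<subseteq> V" "card {u, v} = 2" using tree_basics(4)[OF assms] by auto
  show "u \<in> V" "v \<in> V" "u \<noteq> v" using * by (auto simp: card_2_iff)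
qed

text \<open>Connectedness, in the form in which it is used throughout: a vertex set that is closed under
  adjacency and meets the tree contains it.\<close>

lemma tree_connected:
  assumes "tree V A" "\<And>a b. {a, b} \<in> A \<Longrightarrow> a \<in> X \<Longrightarrow> b \<in> X" "z \<in> V" "z \<in> X"
  shows "V \<subseteq> X"
proof -
  have "V \<subseteq> X \<or> V \<inter> X = {}" using assms(1,2)
  proof induction
    case (single v)
    then show ?case by auto
  next
    case (pendant V A u x)
    have "V \<subseteq> X \<or> V \<inter> X = {}" using pendant by blast
    moreover have "u \<in> X \<longleftrightarrow> x \<in> X"
      using pendant.prems[of u x] pendant.prems[of x u] by (auto simp: insert_commute)
    ultimately show ?case using pendant.hyps by blast
  qed
  then show ?thesis using assms by blast
qed

lemma tree_neighbour:
  assumes "tree V A" "2 \<le> card V" "v \<in> V"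
  obtains w where "{v, w} \<in> A"
proof -
  have "\<not> V \<subseteq> {v}" using assms(2) card_mono[of "{v}" V] by auto
  then have "\<exists>a b. {a, b} \<in> A \<and> a \<in> {v} \<and> b \<notin> {v}"
    using tree_connected[OF assms(1), of "{v}" v] assms(3) by blast
  then show ?thesis using that by blast
qed

lemma tree_bipartite:
  assumes "tree V A"
  obtains p :: "'a \<Rightarrow> bool" where "\<And>u v. {u, v} \<in> A \<Longrightarrow> p u \<noteq> p v"
proof -
  have "\<exists>p :: 'a \<Rightarrow> bool. \<forall>u v. {u, v} \<in> A \<longrightarrow> p u \<noteq> p v" using assms
  proof induction
    case (single v)
    then show ?case by simp
  next
    case (pendant V A u x)
    then obtain p :: "'a \<Rightarrow> bool" where p: "\<forall>u v. {u, v} \<in> A \<longrightarrow> p u \<noteq> p v" by blast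
    have "(p(x := \<not> p u)) a \<noteq> (p(x := \<not> p u)) b" if "{a, b} \<in> insert {u, x} A" for a b
    proof (cases "{a, b} \<in> A")
      case True
      then have "a \<in> V" "b \<in> V" using tree_edge[OF pendant.hyps(1)] by auto
      then show ?thesis using True p pendant.hyps by auto
    next
      case False
      then have "a = u \<and> b = x \<or> a = x \<and> b = u" using that by (auto simp: doubleton_eq_iff)
      then show ?thesis using pendant.hyps by auto
    qed
    then show ?case by blast
  qed
  then show ?thesis using that by blast
qed

text \<open>An edge is replaced by a path of length three. This is the surgery for two vertices
  \<open>v\<close> and \<open>w\<close> that point to each other.\<close>

lemma tree_subdivide:
  assumes "tree V A" "{v, w} \<in> A" "x \<notin> V" "y \<notin> V" "x \<noteq> y"
  shows "tree (insert x (insert y V)) (A - {{v, w}} \<union> {{v, x}, {x, y}, {y, w}})"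
  using assms
proof induction
  case (single v)
  then show ?case by simp
next
  case (pendant V A u z)
  show ?case
  proof (cases "{v, w} \<in> A")
    case True
    have ne: "{u, z} \<noteq> {v, w}" using tree_edge[OF pendant.hyps(1) True] pendant.hyps by auto
    have "tree (insert x (insert y V)) (A - {{v, w}} \<union> {{v, x}, {x, y}, {y, w}})"
      using pendant True by blast
    then have "tree (insert z (insert x (insert y V)))
        (insert {u, z} (A - {{v, w}} \<union> {{v, x}, {x, y}, {y, w}}))"
      by (rule tree.pendant) (use pendant in auto)
    moreover have "insert {u, z} (A - {{v, w}} \<union> {{v, x}, {x, y}, {y, w}})
        = insert {u, z} A - {{v, w}} \<union> {{v, x}, {x, y}, {y, w}}" using ne by auto
    ultimately show ?thesis by (simp add: insert_commute)
  next
    case False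
    then have vw: "v = u \<and> w = z \<or> v = z \<and> w = u"
      and A: "insert {u, z} A - {{v, w}} = A"
      using pendant.prems by (auto simp: doubleton_eq_iff)
    have *: "tree (insert z (insert b (insert a V))) (insert {b, z} (insert {a, b} (insert {u, a} A)))"
      if "a \<notin> insert z V" "b \<notin> insert z V" "a \<noteq> b" for a b
      using that pendant.hyps by (intro tree.pendant) auto
    have 1: "tree (insert z (insert y (insert x V))) (insert {y, z} (insert {x, y} (insert {u, x} A)))"
      using *[of x y] pendant.prems by auto
    have 2: "tree (insert z (insert x (insert y V))) (insert {x, z} (insert {y, x} (insert {u, y} A)))"
      using *[of y x] pendant.prems by auto
    show ?thesis
      using vw
    proof
      assume "v = u \<and> w = z"
      then show ?thesis using 1 unfolding A by (simp add: insert_commute)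
    next
      assume "v = z \<and> w = u"
      then show ?thesis using 2 unfolding A by (simp add: insert_commute)
    qed
  qed
qed

text \<open>\<open>W\<close> is the component of \<open>v\<close> after the removal of the edge \<open>uv\<close>. It is a tree
  itself, and \<open>uv\<close> is the only edge that leaves it.\<close>

definition cut_off :: "'a set \<Rightarrow> 'a set set \<Rightarrow> 'a \<Rightarrow> 'a \<Rightarrow> 'a set \<Rightarrow> bool" where
  "cut_off V A u v W \<longleftrightarrow> W \<subseteq> V \<and> v \<in> W \<and> u \<in> V - W \<and> tree W {e \<in> A. e \<subseteq> W} \<and>
     (\<forall>a b. {a, b} \<in> A \<longrightarrow> a \<in> W \<longrightarrow> b \<notin> W \<longrightarrow> a = v \<and> b = u)"

lemma tree_cut:
  assumes "tree V A" "{u, v} \<in> A"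
  obtains W where "cut_off V A u v W" "cut_off V A v u (V - W)"
proof -
  have "\<exists>V1 V2 A1 A2. tree V1 A1 \<and> tree V2 A2 \<and> u \<in> V1 \<and> v \<in> V2 \<and> V1 \<inter> V2 = {} \<and>
      V = V1 \<union> V2 \<and> A = insert {u, v} (A1 \<union> A2)" (is "\<exists>V1 V2 A1 A2. ?C V A V1 V2 A1 A2")
    using assms
  proof induction
    case (single v)
    then show ?case by simp
  next
    case (pendant V A a x)
    show ?case
    proof (cases "{u, v} \<in> A")
      case True
      then obtain V1 V2 A1 A2 where C: "?C V A V1 V2 A1 A2" using pendant by blast
      show ?thesis
      proof (cases "a \<in> V1")
        case True
        have "tree (insert x V1) (insert {a, x} A1)" using C True pendant.hyps by (auto intro: tree.pendant)
        then have "?C (insert x V) (insert {a, x} A) (insert x V1) V2 (insert {a, x} A1) A2"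
          using C pendant.hyps by auto
        then show ?thesis by - (intro exI)
      next
        case False
        then have "a \<in> V2" using C pendant.hyps by auto
        then have "tree (insert x V2) (insert {a, x} A2)" using C pendant.hyps by (auto intro: tree.pendant)
        then have "?C (insert x V) (insert {a, x} A) V1 (insert x V2) A1 (insert {a, x} A2)"
          using C pendant.hyps by auto
        then show ?thesis by - (intro exI)
      qed
    next
      case False
      then have "u = a \<and> v = x \<or> u = x \<and> v = a" using pendant.prems by (auto simp: doubleton_eq_iff)
      then have "?C (insert x V) (insert {a, x} A) V {x} A {} \<or> ?C (insert x V) (insert {a, x} A) {x} V {} A"
        using pendant.hyps tree.single[of x] by (auto simp: insert_commute)
      then show ?thesis
      proof
        assume "?C (insert x V) (insert {a, x} A) V {x} A {}"
        then show ?thesis by - (intro exI)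
      next
        assume "?C (insert x V) (insert {a, x} A) {x} V {} A"
        then show ?thesis by - (intro exI)
      qed
    qed
  qed
  then obtain V1 V2 A1 A2 where C: "?C V A V1 V2 A1 A2" by blast
  have 1: "e \<subseteq> V1" "e \<noteq> {}" if "e \<in> A1" for e using C tree_basics(4)[of V1 A1 e] that by (auto simp: card_eq_0_iff)
  have 2: "e \<subseteq> V2" "e \<noteq> {}" if "e \<in> A2" for e using C tree_basics(4)[of V2 A2 e] that by (auto simp: card_eq_0_iff)
  have apart: "\<not> e \<subseteq> V1" if "e \<in> A2" for e using 2[OF that] C by blast
  have apart': "\<not> e \<subseteq> V2" if "e \<in> A1" for e using 1[OF that] C by blast
  have A1: "{e \<in> A. e \<subseteq> V1} = A1" using C 1 apart by auto
  have A2: "{e \<in> A. e \<subseteq> V2} = A2" using C 2 apart' by auto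
  have cross: "a = u \<and> b = v" if "{a, b} \<in> A" "a \<in> V1" "b \<in> V2" for a b
  proof -
    have "{a, b} \<notin> A1" "{a, b} \<notin> A2" using 1[of "{a,b}"] 2[of "{a,b}"] that C by auto
    then have "{a, b} = {u, v}" using C that by blast
    then show ?thesis using that C by (auto simp: doubleton_eq_iff)
  qed
  have inV: "a \<in> V \<and> b \<in> V" if "{a, b} \<in> A" for a b using tree_edge[OF assms(1) that] by simp
  have cross': "a = v \<and> b = u" if "{a, b} \<in> A" "a \<in> V2" "b \<in> V1" for a b
    using cross[of b a] that by (simp add: insert_commute)
  have V1: "V - V2 = V1" using C by auto
  have side2: "a = v \<and> b = u" if "{a, b} \<in> A" "a \<in> V2" "b \<notin> V2" for a b
    using cross'[of a b] inV[OF that(1)] that C by blast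
  have side1: "a = u \<and> b = v" if "{a, b} \<in> A" "a \<in> V1" "b \<notin> V1" for a b
    using cross[of a b] inV[OF that(1)] that C by blast
  show ?thesis
  proof (rule that)
    show "cut_off V A u v V2"
      unfolding cut_off_def A2 V1 using C side2 by auto
    have "V - V1 = V2" using C by auto
    then show "cut_off V A v u (V - V2)"
      unfolding V1 cut_off_def A1 using C side1 by auto
  qed
qed

text \<open>Cutting the only edge at \<open>l\<close> leaves \<open>{l}\<close> on one side, so the other side is the rest of the tree.\<close>

lemma tree_delete_leaf:
  assumes "tree V A" "{u, l} \<in> A" "\<And>w. {w, l} \<in> A \<Longrightarrow> w = u"
  shows "tree (V - {l}) (A - {{u, l}})"
proof -
  obtain W where W: "cut_off V A u l W" "cut_off V A l u (V - W)" using tree_cut[OF assms(1,2)] .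
  have "W \<subseteq> {l}"
  proof (rule tree_connected)
    show "tree W {e \<in> A. e \<subseteq> W}" "l \<in> W" using W(1) by (auto simp: cut_off_def)
    show "b \<in> {l}" if "{a, b} \<in> {e \<in> A. e \<subseteq> W}" "a \<in> {l}" for a b
      using that assms(3)[of b] W(1) by (auto simp: cut_off_def insert_commute)
  qed simp
  then have Wl: "W = {l}" using W by (auto simp: cut_off_def)
  have "{e \<in> A. e \<subseteq> V - {l}} = A - {{u, l}}"
  proof
    show "A - {{u, l}} \<subseteq> {e \<in> A. e \<subseteq> V - {l}}"
    proof
      fix e assume e: "e \<in> A - {{u, l}}"
      then have "card e = 2" "e \<subseteq> V" using tree_basics(4)[OF assms(1)] by auto
      moreover have "l \<notin> e"
      proof
        assume "l \<in> e"
        then obtain w where "e = {w, l}" using \<open>card e = 2\<close> by (auto simp: card_2_iff)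
        then show False using assms(3)[of w] e by auto
      qed
      ultimately show "e \<in> {e \<in> A. e \<subseteq> V - {l}}" using e by auto
    qed
  qed auto
  then show ?thesis using W(2) Wl by (simp add: cut_off_def)
qed

definition interior :: "'a set set \<Rightarrow> 'a set" where
  "interior A = {v. \<exists>a b. a \<noteq> b \<and> {v, a} \<in> A \<and> {v, b} \<in> A}"

lemma interior_subset: "tree V A \<Longrightarrow> interior A \<subseteq> V"
  by (auto simp: interior_def dest: tree_edge)

text \<open>The search runs over the vertices that are not leaves. A tree has at least two leaves, which is why
  \<open>e - 1\<close> and not \<open>e + 1\<close> vertices are searched in a tree with \<open>e\<close> edges.\<close>

lemma card_interior:
  assumes "tree V A" "3 \<le> card V"
  shows "interior A \<noteq> {}" "card (interior A) \<le> card V - 2"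
proof -
  have *: "2 \<le> card V \<Longrightarrow> card (interior A) \<le> card V - 2 \<and> (3 \<le> card V \<longrightarrow> interior A \<noteq> {})"
    using assms(1)
  proof induction
    case (single v)
    then show ?case by simp
  next
    case (pendant V A u x)
    have fin: "finite V" "finite (interior A)"
      using tree_basics(1)[OF pendant.hyps(1)] interior_subset[OF pendant.hyps(1)] finite_subset by auto
    have nx: "{x, a} \<notin> A" "{a, x} \<notin> A" for a using tree_edge[OF pendant.hyps(1)] pendant.hyps by blast+
    show ?case
    proof (cases "2 \<le> card V")
      case True
      obtain w where w: "{u, w} \<in> A" using tree_neighbour[OF pendant.hyps(1) True pendant.hyps(2)] .
      have "interior (insert {u, x} A) \<subseteq> insert u (interior A)"
        using nx pendant.hyps by (auto simp: interior_def doubleton_eq_iff)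
      then have "card (interior (insert {u, x} A)) \<le> Suc (card (interior A))"
        using fin card_mono[of "insert u (interior A)"] card_insert_le_m1
        by (metis card_insert_if finite_insert le_SucI order_trans le_refl)
      moreover have "u \<in> interior (insert {u, x} A)"
        using w nx(1)[of u] unfolding interior_def
        using nx(2)[of u] by (intro CollectI exI[of _ w] exI[of _ x]) auto
      ultimately show ?thesis using pendant.IH True fin pendant.hyps by auto
    next
      case False
      then have "card V = 1" using pendant.hyps fin by (cases "card V") auto
      then obtain a where "V = {a}" by (auto simp: card_1_singleton_iff)
      then have "V = {u}" using pendant.hyps by auto
      moreover have "A = {}" using tree_basics(3,5)[OF pendant.hyps(1)] \<open>card V = 1\<close> by auto
      ultimately have "interior (insert {u, x} A) = {}" "card (insert x V) = 2"
        using pendant.hyps by (auto simp: interior_def doubleton_eq_iff)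
      then show ?thesis by simp
    qed
  qed
  show "interior A \<noteq> {}" "card (interior A) \<le> card V - 2" using * assms(2) by auto
qed

text \<open>A weighted centroid: only the vertices in \<open>I\<close> count, and the centroid itself lies in \<open>I\<close>. If some edge
  has more than half of the weight on one side, choose such a side \<open>W\<close> with as few vertices as possible;
  its end \<open>v\<close> in \<open>W\<close> is a centroid, because every other side at \<open>v\<close> is contained in \<open>W - {v}\<close>. If there
  is no such edge, any vertex in \<open>I\<close> will do.\<close>

lemma tree_centroid:
  assumes T: "tree U A" and ne: "U \<inter> I \<noteq> {}"
    and leaf: "\<And>v z z'. v \<in> U - I \<Longrightarrow> {v, z} \<in> A \<Longrightarrow> {v, z'} \<in> A \<Longrightarrow> z = z'"
  obtains u where "u \<in> U \<inter> I"
    "\<And>v. {u, v} \<in> A \<Longrightarrow> \<exists>W. cut_off U A u v W \<and> 2 * card (W \<inter> I) \<le> card (U \<inter> I)"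
proof (cases "\<exists>u v W. cut_off U A u v W \<and> {u, v} \<in> A \<and> card (U \<inter> I) < 2 * card (W \<inter> I)")
  case False
  obtain u where u: "u \<in> U \<inter> I" using ne by blast
  show ?thesis
  proof (rule that[OF u])
    fix v assume "{u, v} \<in> A"
    then show "\<exists>W. cut_off U A u v W \<and> 2 * card (W \<inter> I) \<le> card (U \<inter> I)"
      using tree_cut[OF T] False not_le by metis
  qed
next
  case True
  define heavy where "heavy W \<longleftrightarrow> card (U \<inter> I) < 2 * card (W \<inter> I) \<and> (\<exists>u v. cut_off U A u v W \<and> {u, v} \<in> A)" for W
  have "\<exists>W. heavy W" using True by (auto simp: heavy_def)
  then obtain W where W: "heavy W" and min: "\<And>W'. heavy W' \<Longrightarrow> card W \<le> card W'"
    using exists_least_iff[of "\<lambda>k. \<exists>W. heavy W \<and> card W = k"] by (metis not_le)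
  then obtain u v where uv: "cut_off U A u v W" "{u, v} \<in> A" by (auto simp: heavy_def)
  have big: "card (U \<inter> I) < 2 * card (W \<inter> I)" using W by (simp add: heavy_def)
  have finU: "finite U" using tree_basics(1)[OF T] .
  have W': "W \<subseteq> U" "v \<in> W" "u \<in> U" "u \<notin> W" "tree W {e \<in> A. e \<subseteq> W}"
    and cross: "\<And>a b. {a, b} \<in> A \<Longrightarrow> a \<in> W \<Longrightarrow> b \<notin> W \<Longrightarrow> a = v \<and> b = u"
    using uv(1) by (auto simp: cut_off_def)
  \<comment> \<open>If v had no other neighbor than u, then W would be {v}, a side without weight.\<close>
  have vI: "v \<in> I"
  proof (rule ccontr)
    assume "v \<notin> I"
    have "W \<subseteq> {v}"
    proof (rule tree_connected[OF W'(5) _ W'(2)])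
      fix a b assume ab: "{a, b} \<in> {e \<in> A. e \<subseteq> W}" "a \<in> {v}"
      then have "b = u" using leaf[of v b u] \<open>v \<notin> I\<close> W' uv(2) by (auto simp: insert_commute)
      then show "b \<in> {v}" using ab W' by auto
    qed simp
    then have "W \<inter> I = {}" using \<open>v \<notin> I\<close> by auto
    then show False using big by simp
  qed
  have vUI: "v \<in> U \<inter> I" using vI W' by auto
  show ?thesis
  proof (rule that[OF vUI])
    fix z assume z: "{v, z} \<in> A"
    show "\<exists>W. cut_off U A v z W \<and> 2 * card (W \<inter> I) \<le> card (U \<inter> I)"
    proof (cases "z = u")
      case True
      obtain X where X: "cut_off U A u v X" "cut_off U A v u (U - X)" using tree_cut[OF T uv(2)] .
      \<comment> \<open>The edge uv determines its two sides, by connectedness in both directions.\<close>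
      have "X \<subseteq> W"
      proof (rule tree_connected)
        show "tree X {e \<in> A. e \<subseteq> X}" "v \<in> X" using X(1) by (auto simp: cut_off_def)
        show "b \<in> W" if "{a, b} \<in> {e \<in> A. e \<subseteq> X}" "a \<in> W" for a b
          using that cross[of a b] X(1) by (auto simp: cut_off_def)
      qed (use W' in auto)
      have "W \<subseteq> X"
      proof (rule tree_connected[OF W'(5) _ W'(2)])
        show "b \<in> X" if "{a, b} \<in> {e \<in> A. e \<subseteq> W}" "a \<in> X" for a b
          using that W' X(1) by (auto simp: cut_off_def)
      qed (use X in \<open>auto simp: cut_off_def\<close>)
      then have X': "X = W" using \<open>X \<subseteq> W\<close> by auto
      have "card ((U - W) \<inter> I) + card (W \<inter> I) = card (U \<inter> I)"
        using card_Un_disjoint[of "(U - W) \<inter> I" "W \<inter> I"] finU W'(1) finite_subset[OF W'(1) finU]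
        by (metis Diff_disjoint Int_Un_distrib2 Int_assoc Int_commute Int_left_commute Un_Diff_cancel2 finite_Diff finite_Int inf_bot_right sup.absorb1)
      then show ?thesis using X(2) big X' True by (intro exI[of _ "U - W"]) auto
    next
      case False
      obtain X where X: "cut_off U A v z X" "cut_off U A z v (U - X)" using tree_cut[OF T z] .
      have zW: "z \<in> W" using cross[OF z] W' False by blast
      have vX: "v \<notin> X" using X(1) by (auto simp: cut_off_def)
      have "X \<subseteq> W"
      proof (rule tree_connected)
        show "tree X {e \<in> A. e \<subseteq> X}" "z \<in> X" using X(1) by (auto simp: cut_off_def)
        show "b \<in> W" if "{a, b} \<in> {e \<in> A. e \<subseteq> X}" "a \<in> W" for a b
          using that cross[of a b] vX by auto
      qed (rule zW)
      then have "X \<subset> W" using vX W' by auto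
      then have "card X < card W" using finite_subset[OF W'(1) finU] psubset_card_mono by blast
      then have "\<not> heavy X" using min not_le by blast
      then show ?thesis using X(1) z by (auto simp: heavy_def not_less)
    qed
  qed
qed

section \<open>The game as a tree of queries\<close>

text \<open>\<open>reach n t P m E\<close>: if \<open>m\<close> queries have been made and \<open>E\<close> is what they exposed, then Builder can
  continue in such a way that \<open>P\<close> holds at some later moment of the play, with both arguments updated. Repeated
  queries may be answered inconsistently here, which can only help Painter. The counter is a parameter of \<open>P\<close> so that an adaptive number of queries can be
  weighed against the structure that they produced.\<close>

inductive reach :: "nat \<Rightarrow> nat \<Rightarrow> (nat \<Rightarrow> (nat set \<times> nat) set \<Rightarrow> bool) \<Rightarrow> nat \<Rightarrow> (nat set \<times> nat) set \<Rightarrow> bool"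
  for n t P where
  stop: "P m E \<Longrightarrow> reach n t P m E"
| query: "e \<in> nsets {..<n} 2 \<Longrightarrow> (\<And>c. c \<in> {1..t} \<Longrightarrow> reach n t P (Suc m) (insert (e, c) E))
    \<Longrightarrow> reach n t P m E"

lemma reach_trans:
  assumes "reach n t P m E" "\<And>m E. P m E \<Longrightarrow> reach n t Q m E"
  shows "reach n t Q m E"
  using assms(1)
proof induction
  case (stop m E)
  then show ?case by (rule assms(2))
next
  case (query e m E)
  show ?case by (rule reach.query[OF query(1)]) (rule query.IH)
qed

lemma reach_mono:
  assumes "reach n t P m E" "\<And>m E. P m E \<Longrightarrow> Q m E"
  shows "reach n t Q m E"
  using assms(1) by (rule reach_trans) (rule reach.stop, rule assms(2))

lemma reach_legal:
  assumes "reach n t P m E" "E \<subseteq> nsets {..<n} 2 \<times> {1..t}"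
  shows "reach n t (\<lambda>m E. P m E \<and> E \<subseteq> nsets {..<n} 2 \<times> {1..t}) m E"
  using assms
proof induction
  case (stop m E)
  then show ?case by (intro reach.stop) simp
next
  case (query e m E)
  show ?case
  proof (rule reach.query[OF query.hyps(1)])
    fix c assume c: "c \<in> {1..t}"
    then show "reach n t (\<lambda>m E. P m E \<and> E \<subseteq> nsets {..<n} 2 \<times> {1..t}) (Suc m) (insert (e, c) E)"
      using query.hyps(1) query.prems by (intro query.IH) simp_all
  qed
qed

lemma reach_le:
  assumes "reach n t P m E" "\<And>m E. P m E \<Longrightarrow> m \<le> l" "1 \<le> t"
  shows "m \<le> l"
  using assms(1)
proof induction
  case (stop m E)
  then show ?case using assms(2) by blast
next
  case (query e m E)
  then have "Suc m \<le> l" using assms(3) by auto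
  then show ?case by simp
qed

lemma length_play [simp]: "length (play \<sigma> \<chi> k) = k"
  by (induction k) (auto simp: Let_def)

definition wins :: "nat \<Rightarrow> (nat \<Rightarrow> 'a graph) \<Rightarrow> nat \<Rightarrow> (nat set \<times> nat) set \<Rightarrow> bool" where
  "wins t G n E \<longleftrightarrow> (\<exists>i\<in>{1..t}. contains_copy ({..<n}, {e. (e, i) \<in> E}) (G i))"

text \<open>The strategy queries an arbitrary edge after which the goal is still in reach. It need not follow the
  derivation of \<open>reach\<close>, but it cannot go astray either: as long as the goal is in reach, the counter is at
  most \<open>l\<close> by \<open>reach_le\<close>, so no play without a win lasts for more than \<open>l\<close> rounds.\<close>

lemma reach_winning_strategy:
  assumes reach: "reach n t (\<lambda>m E. m \<le> l \<and> wins t G n E) 0 {}" and t: "1 \<le> t"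
  shows "\<exists>\<sigma>. winning_strategy t G n l \<sigma>"
proof -
  let ?P = "\<lambda>m E. m \<le> l \<and> wins t G n E"
  define good where "good h e \<longleftrightarrow> e \<in> nsets {..<n} 2 \<and>
      (\<forall>c\<in>{1..t}. reach n t ?P (Suc (length h)) (insert (e, c) (set h)))" for h :: history and e
  define \<sigma> :: strategy where "\<sigma> h = (SOME e. good h e)" for h
  have good: "good h (\<sigma> h)" if "reach n t ?P (length h) (set h)" "\<not> wins t G n (set h)" for h
  proof -
    from that(1) have "\<exists>e. good h e"
    proof (cases rule: reach.cases)
      case stop
      then show ?thesis using that(2) by blast
    next
      case (query e)
      then show ?thesis unfolding good_def by blast
    qed
    then show ?thesis unfolding \<sigma>_def by (rule someI_ex)
  qed
  have "winning_strategy t G n l \<sigma>"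
    unfolding winning_strategy_def
  proof
    fix \<chi> assume \<chi>: "\<chi> \<in> edge_colorings t n"
    have inv: "reach n t ?P k (set (play \<sigma> \<chi> k))"
      if "\<And>j. j < k \<Longrightarrow> \<not> wins t G n (set (play \<sigma> \<chi> j))" for k
      using that
    proof (induction k)
      case 0
      show ?case using reach by (simp only: play.simps list.set)
    next
      case (Suc k)
      define h where "h = play \<sigma> \<chi> k"
      have h: "length h = k" "play \<sigma> \<chi> (Suc k) = h @ [(\<sigma> h, \<chi> (\<sigma> h))]" by (simp_all add: h_def Let_def)
      have "reach n t ?P (length h) (set h)" using Suc.IH Suc.prems less_SucI unfolding h_def by simp
      moreover have "\<not> wins t G n (set h)" unfolding h_def using Suc.prems[of k] by simp
      ultimately have g: "good h (\<sigma> h)" by (rule good)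
      then have "\<sigma> h \<in> snd (complete_graph n)" by (simp add: good_def complete_graph_def)
      then have "\<chi> (\<sigma> h) \<in> {1..t}" using \<chi> by (auto simp: edge_colorings_def Pi_iff)
      then have "reach n t ?P (Suc k) (insert (\<sigma> h, \<chi> (\<sigma> h)) (set h))"
        using g h(1) by (simp add: good_def)
      then show ?case unfolding h(2) by simp
    qed
    have "\<exists>k. wins t G n (set (play \<sigma> \<chi> k))"
    proof (rule ccontr)
      assume "\<not> ?thesis"
      then have "reach n t ?P (Suc l) (set (play \<sigma> \<chi> (Suc l)))" by (intro inv) blast
      then have "Suc l \<le> l" by (rule reach_le) (use t in auto)
      then show False by simp
    qed
    then obtain k where k: "wins t G n (set (play \<sigma> \<chi> k))"
      and before: "\<And>j. j < k \<Longrightarrow> \<not> wins t G n (set (play \<sigma> \<chi> j))"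
      using exists_least_iff[of "\<lambda>k. wins t G n (set (play \<sigma> \<chi> k))"] by blast
    have "k \<le> l" by (rule reach_le[OF inv[OF before]]) (use t in auto)
    moreover have "\<sigma> (play \<sigma> \<chi> j) \<in> snd (complete_graph n)" if "j < k" for j
      using good[of "play \<sigma> \<chi> j"] inv[of j] before that
      by (auto simp: good_def complete_graph_def)
    ultimately show "\<exists>k\<le>l. (\<forall>j<k. \<sigma> (play \<sigma> \<chi> j) \<in> snd (complete_graph n)) \<and>
        builder_wins t G n (play \<sigma> \<chi> k)"
      using k by (auto simp: builder_wins_def wins_def)
  qed
  then show ?thesis by blast
qed


section \<open>Matchings and extremal colorings\<close>

lemma contains_matching_iff:
  assumes "B \<subseteq> nsets U 2"
  shows "contains_copy (U, B) (matching_graph r) \<longleftrightarrow>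
    (\<exists>M\<subseteq>B. finite M \<and> card M = r \<and> disjoint M)"
proof
  assume "contains_copy (U, B) (matching_graph r)"
  then obtain f where inj: "inj_on f {..<2 * r}"
    and f: "\<forall>e\<in>{{2 * i, 2 * i + 1} | i. i < r}. f ` e \<in> B"
    unfolding contains_copy_def matching_graph_def fst_conv snd_conv by blast
  have fB: "f ` {2 * i, 2 * i + 1} \<in> B" if "i < r" for i using f that by blast
  define g where "g i = f ` {2 * i, 2 * i + 1}" for i
  have disj: "g i \<inter> g j = {}" if "i < r" "j < r" "i \<noteq> j" for i j
  proof -
    have "f ` {2 * i, 2 * i + 1} \<inter> f ` {2 * j, 2 * j + 1} = f ` ({2 * i, 2 * i + 1} \<inter> {2 * j, 2 * j + 1})"
      using that by (intro inj_on_image_Int[OF inj, symmetric]) auto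
    also have "{2 * i, 2 * i + 1} \<inter> {2 * j, 2 * j + 1} = {}" using that by auto
    finally show ?thesis by (simp add: g_def)
  qed
  have "inj_on g {..<r}"
  proof
    fix i j assume "i \<in> {..<r}" "j \<in> {..<r}" "g i = g j"
    then show "i = j" using disj[of i j] by (auto simp: g_def)
  qed
  then have "card (g ` {..<r}) = r" by (simp add: card_image)
  moreover have "g ` {..<r} \<subseteq> B" using fB by (auto simp: g_def)
  moreover have "disjoint (g ` {..<r})"
    unfolding disjoint_def using disj by (metis (no_types, lifting) imageE lessThan_iff)
  ultimately show "\<exists>M\<subseteq>B. finite M \<and> card M = r \<and> disjoint M" by blast
next
  assume "\<exists>M\<subseteq>B. finite M \<and> card M = r \<and> disjoint M"
  then obtain M where M: "M \<subseteq> B" "finite M" "card M = r" "disjoint M" by blast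
  obtain g where g: "bij_betw g {..<r} M" using M(2,3) ex_bij_betw_nat_finite[of M] by (auto simp: atLeast0LessThan)
  have gM: "g i \<in> M" if "i < r" for i using g that by (auto simp: bij_betw_def)
  have "\<exists>a b. g i = {a, b} \<and> a \<noteq> b" if "i < r" for i
  proof -
    have "g i \<in> nsets U 2" using gM[OF that] M(1) assms by blast
    then show ?thesis by (auto simp: nsets_def card_2_iff)
  qed
  then obtain a b where ab: "\<And>i. i < r \<Longrightarrow> g i = {a i, b i} \<and> a i \<noteq> b i" by metis
  define f where "f v = (if even v then a (v div 2) else b (v div 2))" for v
  have fg: "f v \<in> g (v div 2)" if "v < 2 * r" for v
    using ab[of "v div 2"] that by (auto simp: f_def)
  have "inj_on f {..<2 * r}"
  proof
    fix v w assume v: "v \<in> {..<2 * r}" and w: "w \<in> {..<2 * r}" and eq: "f v = f w"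
    have lt: "v div 2 < r" "w div 2 < r" using v w by auto
    have "f v \<in> g (v div 2) \<inter> g (w div 2)" using fg[of v] fg[of w] v w eq by auto
    then have "g (v div 2) = g (w div 2)"
      using M(4) gM[OF lt(1)] gM[OF lt(2)] unfolding disjoint_def by blast
    then have d: "v div 2 = w div 2" using g lt unfolding bij_betw_def inj_on_def by auto
    have "even v = even w" using eq ab[OF lt(1)] by (auto simp: f_def d split: if_splits)
    then show "v = w" using d by (metis div_mult_mod_eq even_iff_mod_2_eq_zero odd_iff_mod_2_eq_one)
  qed
  moreover have "f ` {2 * i, 2 * i + 1} \<in> B" if "i < r" for i
    using ab[OF that] gM[OF that] M(1) by (auto simp: f_def insert_commute)
  moreover have "f ` {..<2 * r} \<subseteq> U"
  proof
    fix x assume "x \<in> f ` {..<2 * r}"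
    then obtain v where v: "v < 2 * r" "x = f v" by auto
    then have "v div 2 < r" by auto
    then have "g (v div 2) \<in> nsets U 2" using gM M(1) assms by blast
    then show "x \<in> U" using fg[OF v(1)] v(2) by (auto simp: nsets_def)
  qed
  ultimately show "contains_copy (U, B) (matching_graph r)"
    unfolding contains_copy_def matching_graph_def by (intro exI[of _ f]) auto
qed

text \<open>The colors are filled one after the other up to their capacities.\<close>

lemma fibre_bounded_labelling:
  assumes "finite I" "finite A" "card A \<le> (\<Sum>i\<in>I. k i)"
  shows "\<exists>l. l ` A \<subseteq> I \<and> (\<forall>i\<in>I. card {v \<in> A. l v = i} \<le> k i)"
  using assms
proof (induction I arbitrary: A)
  case empty
  then show ?case by simp
next
  case (insert i I)
  obtain B where B: "B \<subseteq> A" "card B = min (k i) (card A)"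
    using obtain_subset_with_card_n[of "min (k i) (card A)" A] by auto
  have "card (A - B) \<le> (\<Sum>i\<in>I. k i)"
    using B insert.prems insert.hyps by (auto simp: card_Diff_subset finite_subset)
  then obtain l where l: "l ` (A - B) \<subseteq> I" "\<And>j. j \<in> I \<Longrightarrow> card {v \<in> A - B. l v = j} \<le> k j"
    using insert.IH[of "A - B"] insert.prems by auto
  define l' where "l' v = (if v \<in> B then i else l v)" for v
  have "{v \<in> A. l' v = i} = B" using B l(1) insert.hyps by (auto simp: l'_def)
  moreover have "{v \<in> A. l' v = j} = {v \<in> A - B. l v = j}" if "j \<in> I" for j
    using that insert.hyps by (auto simp: l'_def)
  ultimately have "\<forall>j\<in>insert i I. card {v \<in> A. l' v = j} \<le> k j" using l B by auto
  moreover have "l' ` A \<subseteq> insert i I" using l(1) by (auto simp: l'_def)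
  ultimately show ?case by blast
qed

text \<open>The extremal coloring of Cockayne and Lorimer. The first \<open>2 r\<^sub>m - 1\<close> vertices span a clique of color \<open>m\<close>,
  too small for \<open>r\<^sub>m\<close> disjoint edges. The other vertices are labelled so that at most \<open>r\<^sub>i - 1\<close> of them get
  label \<open>i\<close>, and an edge inherits the label of its larger end, so that these vertices cover all edges of
  color \<open>i\<close>.\<close>

lemma matching_avoiding_coloring:
  fixes r :: "nat \<Rightarrow> nat"
  assumes m: "m \<in> {1..t}" and pos: "\<And>i. i \<in> {1..t} \<Longrightarrow> r i > 0"
    and n: "n \<le> (\<Sum>i=1..t. r i - 1) + r m"
  shows "\<exists>\<chi>\<in>edge_colorings t n. \<forall>i\<in>{1..t}.
    \<not> contains_copy ({..<n}, {e \<in> snd (complete_graph n). \<chi> e = i}) (matching_graph (r i))"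
proof -
  define q where "q = 2 * r m - 1"
  have "card {q..<n} \<le> (\<Sum>i\<in>{1..t} - {m}. r i - 1)"
  proof -
    have "(\<Sum>i=1..t. r i - 1) = (r m - 1) + (\<Sum>i\<in>{1..t} - {m}. r i - 1)"
      using m by (simp add: sum.remove)
    then show ?thesis using n pos[OF m] by (auto simp: q_def)
  qed
  then obtain l where l: "l ` {q..<n} \<subseteq> {1..t} - {m}"
    and small: "\<And>i. i \<in> {1..t} - {m} \<Longrightarrow> card {v \<in> {q..<n}. l v = i} \<le> r i - 1"
    using fibre_bounded_labelling[of "{1..t} - {m}" "{q..<n}" "\<lambda>i. r i - 1"] by auto
  define \<chi> where "\<chi> e = (if Max e < q then m else l (Max e))" for e :: "nat set"
  have Max: "Max e \<in> e \<and> Max e < n" if "e \<in> nsets {..<n} 2" for e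
  proof -
    have "finite e" "e \<noteq> {}" "e \<subseteq> {..<n}" using that by (auto simp: nsets_def)
    then show ?thesis using Max_in[of e] by auto
  qed
  have "\<chi> e \<in> {1..t}" if "e \<in> nsets {..<n} 2" for e
  proof (cases "Max e < q")
    case False
    then have "Max e \<in> {q..<n}" using Max[OF that] by auto
    then have "l (Max e) \<in> {1..t} - {m}" using l by blast
    then show ?thesis using False by (simp add: \<chi>_def)
  qed (use m in \<open>simp add: \<chi>_def\<close>)
  then have "\<chi> \<in> edge_colorings t n" by (simp add: edge_colorings_def complete_graph_def)
  moreover have "\<not> contains_copy ({..<n}, {e \<in> snd (complete_graph n). \<chi> e = i}) (matching_graph (r i))"
    if i: "i \<in> {1..t}" for i
  proof
    assume "contains_copy ({..<n}, {e \<in> snd (complete_graph n). \<chi> e = i}) (matching_graph (r i))"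
    then obtain M where M: "M \<subseteq> {e \<in> nsets {..<n} 2. \<chi> e = i}" "finite M" "card M = r i" "disjoint M"
      by (subst (asm) contains_matching_iff) (auto simp: complete_graph_def)
    have M': "e \<in> nsets {..<n} 2" "\<chi> e = i" if "e \<in> M" for e using M(1) that by auto
    show False
    proof (cases "i = m")
      case True
      have sub: "e \<subseteq> {..<q}" if "e \<in> M" for e
      proof -
        have "Max e < q"
        proof (rule ccontr)
          assume "\<not> Max e < q"
          then have "l (Max e) = m" "Max e \<in> {q..<n}" using M'[OF that] True Max by (auto simp: \<chi>_def)
          then show False using l by blast
        qed
        moreover have "finite e" using M'(1)[OF that] by (auto simp: nsets_def)
        ultimately show ?thesis using Max_ge le_less_trans by blast
      qed
      have "card (\<Union>M) = (\<Sum>e\<in>M. card e)"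
        using M(4) M'(1) by (intro card_Union_disjoint) (auto simp: nsets_def disjoint_def pairwise_def disjnt_def)
      also have "\<dots> = (\<Sum>e\<in>M. 2)" using M'(1) by (intro sum.cong) (auto simp: nsets_def)
      also have "\<dots> = 2 * r m" using M(3) True by simp
      finally have "2 * r m \<le> card {..<q}" using sub card_mono[of "{..<q}" "\<Union>M"] by auto
      then show False using pos[OF m] by (auto simp: q_def)
    next
      case False
      have "Max ` M \<subseteq> {v \<in> {q..<n}. l v = i}"
      proof
        fix v assume "v \<in> Max ` M"
        then obtain e where e: "e \<in> M" "v = Max e" by auto
        then have "\<not> v < q" using M'(2)[OF e(1)] False by (auto simp: \<chi>_def)
        then show "v \<in> {v \<in> {q..<n}. l v = i}" using M'[OF e(1)] Max[of e] e(2) by (auto simp: \<chi>_def)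
      qed
      moreover have "inj_on Max M"
      proof
        fix e e' assume e: "e \<in> M" "e' \<in> M" "Max e = Max e'"
        then have "Max e \<in> e \<inter> e'" using M'(1) Max by fastforce
        then show "e = e'" using M(4) e unfolding disjoint_def by blast
      qed
      ultimately have "r i \<le> card {v \<in> {q..<n}. l v = i}"
        using card_inj_on_le[of Max M] M(3) by auto
      then show False using small[of i] i False pos[OF i] by auto
    qed
  qed
  ultimately show ?thesis by blast
qed

section \<open>Properly colored trees\<close>

type_synonym colored_edges = "(nat set \<times> nat) set"

text \<open>A piece is a properly colored tree, with the colors attached to the edges: every color class is a matching,
  so that \<open>card F = card V - 1\<close> is the sum of the sizes of these matchings.\<close>

definition piece :: "nat set \<Rightarrow> colored_edges \<Rightarrow> bool" where
  "piece V F \<longleftrightarrow> tree V (fst ` F) \<and> inj_on fst F \<and>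
     (\<forall>d e i. (d, i) \<in> F \<longrightarrow> (e, i) \<in> F \<longrightarrow> d \<noteq> e \<longrightarrow> d \<inter> e = {})"

lemma piece_tree: "piece V F \<Longrightarrow> tree V (fst ` F)"
  by (simp add: piece_def)

lemma piece_color_unique: "piece V F \<Longrightarrow> (e, i) \<in> F \<Longrightarrow> (e, j) \<in> F \<Longrightarrow> i = j"
  unfolding piece_def inj_on_def by force

lemma piece_proper: "piece V F \<Longrightarrow> (d, i) \<in> F \<Longrightarrow> (e, i) \<in> F \<Longrightarrow> d \<noteq> e \<Longrightarrow> d \<inter> e = {}"
  unfolding piece_def by blast

lemma piece_edge:
  assumes "piece V F" "({u, v}, i) \<in> F"
  shows "{u, v} \<in> fst ` F" "u \<in> V" "v \<in> V" "u \<noteq> v"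
proof -
  show "{u, v} \<in> fst ` F" using assms(2) by force
  then show "u \<in> V" "v \<in> V" "u \<noteq> v" using tree_edge[OF piece_tree[OF assms(1)]] by auto
qed

lemma piece_subset: "piece V F \<Longrightarrow> (e, i) \<in> F \<Longrightarrow> e \<subseteq> V"
  using tree_basics(4)[OF piece_tree, of V F e] image_eqI[of e fst "(e, i)" F] by simp

lemma piece_finite:
  assumes "piece V F"
  shows "finite V" "finite F" "V \<noteq> {}"
proof -
  show "finite V" "V \<noteq> {}" using tree_basics(1,2)[OF piece_tree[OF assms]] by auto
  have "inj_on fst F" using assms by (simp add: piece_def)
  then show "finite F" using tree_basics(3)[OF piece_tree[OF assms]] finite_imageD by blast
qed

lemma piece_card: "piece V F \<Longrightarrow> Suc (card F) = card V"
  using tree_basics(5)[OF piece_tree, of V F] card_image[of fst F] by (simp add: piece_def)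

lemma piece_remove_edge:
  assumes "piece V F" "(e, i) \<in> F"
  shows "fst ` (F - {(e, i)}) = fst ` F - {e}"
  using inj_on_image_set_diff[of fst F F "{(e, i)}"] assms by (simp add: piece_def)

lemma piece_single_edge:
  assumes "x \<noteq> y"
  shows "piece {x, y} {({x, y}, c)}"
proof -
  have "tree (insert y {x}) (insert {x, y} {})" using assms by (intro tree.intros) auto
  then show ?thesis by (simp add: piece_def insert_commute)
qed

lemma piece_pendant:
  assumes P: "piece V F" and u: "u \<in> V" "x \<notin> V" and free: "\<And>w. ({u, w}, i) \<notin> F"
  shows "piece (insert x V) (insert ({u, x}, i) F)"
proof -
  have "tree (insert x V) (fst ` insert ({u, x}, i) F)"
    using tree.pendant[OF piece_tree[OF P] u] by simp
  moreover have "inj_on fst (insert ({u, x}, i) F)"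
    using P piece_subset[OF P] u by (fastforce simp: piece_def)
  moreover have "e \<inter> {u, x} = {}" if e: "(e, i) \<in> F" for e
  proof -
    have "e \<subseteq> V" "card e = 2" using tree_basics(4)[OF piece_tree[OF P], of e] e by force+
    moreover have "u \<notin> e"
    proof
      assume "u \<in> e"
      then obtain w where "e = {u, w}" using \<open>card e = 2\<close> by (auto simp: card_2_iff)
      then show False using free e by blast
    qed
    ultimately show ?thesis using u by auto
  qed
  then have "\<forall>d e k. (d, k) \<in> insert ({u, x}, i) F \<longrightarrow> (e, k) \<in> insert ({u, x}, i) F \<longrightarrow> d \<noteq> e \<longrightarrow> d \<inter> e = {}"
    using piece_proper[OF P] by (auto; blast)
  ultimately show ?thesis by (simp add: piece_def)
qed

lemma piece_delete_leaf:
  assumes P: "piece V F" and e: "({u, l}, i) \<in> F" and leaf: "l \<notin> interior (fst ` F)"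
  shows "piece (V - {l}) (F - {({u, l}, i)})"
proof -
  have "{u, l} \<in> fst ` F" using piece_edge[OF P e] by simp
  moreover have "w = u" if "{w, l} \<in> fst ` F" for w
  proof (rule ccontr)
    assume "w \<noteq> u"
    then have "l \<in> interior (fst ` F)"
      using that \<open>{u, l} \<in> fst ` F\<close> unfolding interior_def insert_commute[of _ l] by blast
    then show False using leaf by simp
  qed
  ultimately have "tree (V - {l}) (fst ` F - {{u, l}})" by (intro tree_delete_leaf piece_tree P)
  then have "tree (V - {l}) (fst ` (F - {({u, l}, i)}))" unfolding piece_remove_edge[OF P e] .
  moreover have "inj_on fst (F - {({u, l}, i)})" using P by (simp add: piece_def inj_on_diff)
  ultimately show ?thesis using piece_proper[OF P] unfolding piece_def by blast
qed

text \<open>The result of merging the edge \<open>xy\<close> into a piece: exactly one more color, and one or two more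
  edges. That a gain of two edges requires three old ones is what makes the accounting work, see
  \<open>tree_cost\<close>.\<close>

definition grows :: "nat set \<Rightarrow> colored_edges \<Rightarrow> nat \<Rightarrow> nat \<Rightarrow> nat set \<Rightarrow> colored_edges \<Rightarrow> bool" where
  "grows V F x y V' F' \<longleftrightarrow> piece V' F' \<and> V' \<subseteq> insert x (insert y V) \<and> snd ` F \<subseteq> snd ` F' \<and>
     card (snd ` F') = Suc (card (snd ` F)) \<and>
     (card F' = card F + 1 \<or> card F' = card F + 2 \<and> 3 \<le> card F)"

lemma grows_commute: "grows V F x y V' F' \<longleftrightarrow> grows V F y x V' F'"
  by (simp add: grows_def insert_commute)

lemma grows_new_color:
  assumes P: "piece V F" and u: "u \<in> V" "x \<notin> V" and i: "i \<notin> snd ` F"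
  shows "grows V F x y (insert x V) (insert ({u, x}, i) F)"
proof -
  have "({u, x}, i) \<notin> F" using i by force
  moreover have "piece (insert x V) (insert ({u, x}, i) F)"
    using i by (intro piece_pendant P u) force
  ultimately show ?thesis using i piece_finite[OF P] by (auto simp: grows_def)
qed

lemma card_insert_color:
  assumes "finite F" "c \<notin> snd ` F" "snd ` F' = insert c (snd ` F)"
  shows "snd ` F \<subseteq> snd ` F'" "card (snd ` F') = Suc (card (snd ` F))"
  using assms by auto

text \<open>The leaf \<open>v\<close> loses its place to \<open>x\<close>, which is attached to \<open>u\<close> by an edge of the same color; then \<open>y\<close> is
  attached to \<open>x\<close> by the missing color \<open>c\<close>.\<close>

lemma grows_drop_leaf:
  assumes P: "piece V F" and xy: "x \<notin> V" "y \<notin> V" "x \<noteq> y" and c: "c \<notin> snd ` F"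
    and e: "({u, v}, i) \<in> F" and leaf: "v \<notin> interior (fst ` F)"
  shows "grows V F x y (insert y (insert x (V - {v})))
    (insert ({x, y}, c) (insert ({u, x}, i) (F - {({u, v}, i)})))" (is "grows V F x y ?V ?F")
proof -
  have uv: "u \<in> V" "v \<in> V" "u \<noteq> v" using piece_edge[OF P e] by auto
  have Q: "piece (V - {v}) (F - {({u, v}, i)})" by (rule piece_delete_leaf[OF P e leaf])
  have "({u, w}, i) \<notin> F - {({u, v}, i)}" for w
  proof
    assume w: "({u, w}, i) \<in> F - {({u, v}, i)}"
    then have "{u, w} \<noteq> {u, v}" by auto
    then have "{u, w} \<inter> {u, v} = {}" using piece_proper[OF P _ e] w by blast
    then show False by simp
  qed
  then have Q': "piece (insert x (V - {v})) (insert ({u, x}, i) (F - {({u, v}, i)}))"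
    using uv xy by (intro piece_pendant[OF Q]) auto
  have ic: "i \<noteq> c" using c e by force
  have Q'': "piece ?V ?F"
    using c ic xy by (intro piece_pendant[OF Q']) (auto simp: image_iff; force)+
  have fin: "finite F" using piece_finite[OF P] by auto
  have "snd ` (insert ({u, x}, i) (F - {({u, v}, i)})) = snd ` F" using e by (auto simp: image_iff; force)
  then have "snd ` ?F = insert c (snd ` F)" by simp
  note col = card_insert_color[OF fin c this]
  have "Suc (card ?F) = card ?V" using piece_card[OF Q''] .
  also have "card ?V = Suc (card V)" using uv xy piece_finite(1)[OF P] card_Suc_Diff1[of V v] by simp
  also have "card V = Suc (card F)" using piece_card[OF P] by simp
  finally have "card ?F = card F + 1" by simp
  then show ?thesis using Q'' col uv by (auto simp: grows_def)
qed

text \<open>If color \<open>i\<close> occurs in the tree but not at \<open>u\<close>, then an edge from \<open>u\<close> to \<open>x\<close> of color \<open>i\<close>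
  keeps the coloring proper. As \<open>u\<close> has two neighbors, neither joined to it by \<open>i\<close>, the tree has at least three
  edges.\<close>

lemma grows_double:
  assumes P: "piece V F" and xy: "x \<notin> V" "y \<notin> V" "x \<noteq> y" and c: "c \<notin> snd ` F"
    and u: "u \<in> interior (fst ` F)" and i: "i \<in> snd ` F" "\<And>v. ({u, v}, i) \<notin> F"
  shows "grows V F x y (insert y (insert x V)) (insert ({x, y}, c) (insert ({u, x}, i) F))"
    (is "grows V F x y ?V ?F")
proof -
  have uV: "u \<in> V" using u interior_subset[OF piece_tree[OF P]] by auto
  have Q: "piece (insert x V) (insert ({u, x}, i) F)" by (rule piece_pendant[OF P uV xy(1) i(2)])
  have ic: "i \<noteq> c" using c i by auto
  have Q': "piece ?V ?F"
    using c ic xy by (intro piece_pendant[OF Q]) (auto simp: image_iff; force)+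
  have fin: "finite F" "finite V" using piece_finite[OF P] by auto
  have "snd ` ?F = insert c (snd ` F)" using i by auto
  note col = card_insert_color[OF fin(1) c this]
  have "Suc (card ?F) = card V + 2" using piece_card[OF Q'] xy fin by simp
  then have card: "card ?F = card F + 2" using piece_card[OF P] by simp
  obtain a b where ab: "a \<noteq> b" "{u, a} \<in> fst ` F" "{u, b} \<in> fst ` F" using u by (auto simp: interior_def)
  obtain k l e where F: "({u, a}, k) \<in> F" "({u, b}, l) \<in> F" "(e, i) \<in> F" using ab i by force
  have "{({u, a}, k), ({u, b}, l), (e, i)} \<subseteq> F" using F by auto
  moreover have "card {({u, a}, k), ({u, b}, l), (e, i)} = 3"
  proof -
    have "k \<noteq> i" "l \<noteq> i" using F i(2) by blast+
    moreover have "({u, a}, k) \<noteq> ({u, b}, l)" using ab(1) by (auto simp: doubleton_eq_iff)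
    ultimately show ?thesis by auto
  qed
  ultimately have "3 \<le> card F" using card_mono[OF fin(1)] by metis
  then show ?thesis using Q' col card by (auto simp: grows_def)
qed

lemma inj_on_disjoint_images:
  "inj_on f A \<Longrightarrow> inj_on f B \<Longrightarrow> f ` A \<inter> f ` B = {} \<Longrightarrow> inj_on f (A \<union> B)"
  unfolding inj_on_Un by blast

text \<open>The edge \<open>uv\<close> of color \<open>i\<close> becomes a path \<open>u, x, y, v\<close> with colors \<open>i, c, i\<close>. Nothing changes
  at \<open>u\<close> and \<open>v\<close> as far as colors are concerned.\<close>

lemma grows_subdivide:
  assumes P: "piece V F" and xy: "x \<notin> V" "y \<notin> V" "x \<noteq> y" and c: "c \<notin> snd ` F"
    and e: "({u, v}, i) \<in> F" and big: "3 \<le> card F"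
  shows "grows V F x y (insert x (insert y V))
    (F - {({u, v}, i)} \<union> {({u, x}, i), ({x, y}, c), ({y, v}, i)})" (is "grows V F x y ?V ?F")
proof -
  have uv: "u \<in> V" "v \<in> V" "u \<noteq> v" "{u, v} \<in> fst ` F" using piece_edge[OF P e] by auto
  have ic: "i \<noteq> c" using c e by force
  have rest: "d \<inter> {u, v} = {}" if "(d, i) \<in> F" "d \<noteq> {u, v}" for d
    using piece_proper[OF P that(1) e that(2)] .
  have sub: "d \<subseteq> V" if "(d, k) \<in> F" for d k using piece_subset[OF P that] .
  have "fst ` ?F = fst ` F - {{u, v}} \<union> {{u, x}, {x, y}, {y, v}}"
    using piece_remove_edge[OF P e] by (simp add: image_Un)
  then have T: "tree ?V (fst ` ?F)" using tree_subdivide[OF piece_tree[OF P] uv(4) xy] by simp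
  have inj: "inj_on fst ?F"
  proof -
    have "inj_on fst (F - {({u, v}, i)})" using P by (simp add: piece_def inj_on_diff)
    moreover have "inj_on fst {({u, x}, i), ({x, y}, c), ({y, v}, i)}"
      using uv xy by (auto simp: inj_on_def doubleton_eq_iff)
    moreover have "fst ` (F - {({u, v}, i)}) \<inter> fst ` {({u, x}, i), ({x, y}, c), ({y, v}, i)} = {}"
      using sub xy by fastforce
    ultimately show ?thesis by (rule inj_on_disjoint_images)
  qed
  have old: "d \<inter> d' = {}" if "(d, i) \<in> F" "(d, i) \<noteq> ({u, v}, i)" "d' = {u, x} \<or> d' = {y, v}" for d d'
    using rest[of d] sub[of d i] that xy by auto
  have notc: "(d, c) \<notin> F" for d using c by force
  have proper: "d \<inter> d' = {}" if dd: "(d, k) \<in> ?F" "(d', k) \<in> ?F" "d \<noteq> d'" for d d' k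
  proof -
    have new: "k = c \<and> e = {x, y} \<or> k = i \<and> (e = {u, x} \<or> e = {y, v})"
      if "(e, k) \<in> ?F" "(e, k) \<notin> F" for e using that by blast
    have ends: "{u, x} \<inter> {y, v} = {}" using uv xy by auto
    have gone: "({u, v}, i) \<notin> ?F" using uv xy by (auto simp: doubleton_eq_iff)
    have mixed: "e \<inter> e' = {}" if "(e, k) \<in> F" "(e, k) \<in> ?F" "(e', k) \<in> ?F" "(e', k) \<notin> F" for e e'
      using new[OF that(3,4)]
    proof
      assume "k = c \<and> e' = {x, y}"
      then show ?thesis using that(1) notc by blast
    next
      assume k: "k = i \<and> (e' = {u, x} \<or> e' = {y, v})"
      then have "(e, i) \<noteq> ({u, v}, i)" using that(2) gone by blast
      then show ?thesis using old[of e e'] that(1) k by blast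
    qed
    show ?thesis
    proof (cases "(d, k) \<in> F"; cases "(d', k) \<in> F")
      assume "(d, k) \<in> F" "(d', k) \<in> F"
      then show ?thesis using piece_proper[OF P] dd(3) by blast
    next
      assume "(d, k) \<in> F" "(d', k) \<notin> F"
      then show ?thesis using mixed dd by blast
    next
      assume "(d, k) \<notin> F" "(d', k) \<in> F"
      then show ?thesis using mixed[of d' d] dd by blast
    next
      assume "(d, k) \<notin> F" "(d', k) \<notin> F"
      then show ?thesis using new[of d] new[of d'] dd ic ends by blast
    qed
  qed
  have Q: "piece ?V ?F"
    unfolding piece_def by (intro conjI T inj allI impI) (rule proper; assumption)
  have fin: "finite F" "finite V" using piece_finite[OF P] by auto
  have "i \<in> snd ` F" using e by force
  moreover have "snd ` (F - {({u, v}, i)}) \<union> {i} = insert i (snd ` F)" by force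
  ultimately have "snd ` ?F = insert c (snd ` F)" by (auto simp: image_Un)
  note col = card_insert_color[OF fin(1) c this]
  have "Suc (card ?F) = card V + 2" using piece_card[OF Q] xy fin by simp
  then have "card ?F = card F + 2" using piece_card[OF P] by simp
  then show ?thesis using Q col big by (auto simp: grows_def)
qed

section \<open>Prices\<close>

text \<open>The worst-case number of queries from a tree with \<open>e\<close> edges to a fresh edge; the binary search
  runs over its at most \<open>e - 1\<close> inner vertices, and a single edge needs one query.\<close>

definition search_cost :: "nat \<Rightarrow> nat" where
  "search_cost e = max 1 (floorlog 2 (e - 1))"

text \<open>The price of the next edge of a tree with \<open>e\<close> edges: one query for the fresh pair, and the search. The
  first edge (\<open>e = 0\<close>) is a fresh pair itself.\<close>

definition edge_cost :: "nat \<Rightarrow> nat" where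
  "edge_cost e = (if e = 0 then 1 else Suc (search_cost e))"

definition total_cost :: "nat \<Rightarrow> nat" where
  "total_cost e = (\<Sum>k<e. edge_cost k)"

definition single_step_bound :: "nat \<Rightarrow> real" where
  "single_step_bound s = 2 * real s - 1 + (real s - 3) * lg (real s - 2)"

definition rate :: "nat \<Rightarrow> real" where
  "rate s = single_step_bound s / (real s + 1)"

lemma edge_cost_le_log: "2 \<le> e \<Longrightarrow> edge_cost e \<le> 2 + log 2 (real e - 1)"
proof -
  assume e: "2 \<le> e"
  have "real (floorlog 2 (e - 1)) \<le> 1 + log 2 (real e - 1)"
  proof -
    have "0 \<le> log 2 (real (e - 1))" using e by simp
    then have "real (floorlog 2 (e - 1)) = of_int \<lfloor>log 2 (real (e - 1))\<rfloor> + 1"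
      using e by (simp add: floorlog_def)
    also have "\<dots> \<le> log 2 (real (e - 1)) + 1" by simp
    finally show ?thesis using e by (simp add: of_nat_diff)
  qed
  moreover have "0 \<le> log 2 (real e - 1)" using e by simp
  ultimately show ?thesis using e by (simp add: edge_cost_def search_cost_def max_def)
qed

text \<open>From \<open>s\<close> to \<open>s + 1\<close> the right-hand side grows by at least \<open>2 + lg (s - 1)\<close>, because its
  coefficient \<open>s - 3\<close> already multiplies the smaller \<open>lg (s - 2)\<close>. For \<open>s = 2\<close> the
  convention \<open>lg 0 = 0\<close> makes it equal to \<open>3\<close>.\<close>

lemma total_cost_le_single_step_bound: "2 \<le> s \<Longrightarrow> total_cost s \<le> single_step_bound s"
proof (induction s rule: nat_induct_at_least)
  case base
  have "total_cost 2 = edge_cost 0 + edge_cost 1" by (simp add: total_cost_def numeral_2_eq_2)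
  then show ?case by (simp add: edge_cost_def search_cost_def single_step_bound_def lg_def floorlog_def)
next
  case (Suc s)
  have *: "total_cost (Suc s) = total_cost s + edge_cost s" by (simp add: total_cost_def)
  show ?case
  proof (cases "s = 2")
    case True
    have "edge_cost 2 \<le> 2" using edge_cost_le_log[of 2] by simp
    then show ?thesis using * Suc.IH True by (simp add: single_step_bound_def lg_def)
  next
    case False
    then have s: "3 \<le> s" using Suc by simp
    have "(real s - 3) * log 2 (real s - 2) \<le> (real s - 3) * log 2 (real s - 1)"
      using s by (intro mult_left_mono) auto
    moreover have "single_step_bound (Suc s) = 2 * real s + 1 + (real s - 2) * log 2 (real s - 1)"
      using s by (simp add: single_step_bound_def lg_def)
    moreover have "single_step_bound s = 2 * real s - 1 + (real s - 3) * log 2 (real s - 2)"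
      using s by (simp add: single_step_bound_def lg_def)
    ultimately have "single_step_bound s + 2 + log 2 (real s - 1) \<le> single_step_bound (Suc s)"
      by (simp add: algebra_simps)
    then show ?thesis using * Suc.IH edge_cost_le_log[of s] Suc.hyps by simp
  qed
qed

lemma rate_eq:
  assumes "3 \<le> s"
  shows "rate s = 2 - 3 / (real s + 1) + (1 - 4 / (real s + 1)) * log 2 (real s - 2)"
proof -
  have "(2 * x - 1 + (x - 3) * L) / (x + 1) = 2 - 3 / (x + 1) + (1 - 4 / (x + 1)) * L"
    if "x + 1 \<noteq> 0" for x L :: real
  proof -
    have "1 - 4 / (x + 1) = (x - 3) / (x + 1)" "2 - 3 / (x + 1) = (2 * x - 1) / (x + 1)"
      using that by (simp_all add: field_simps)
    then show ?thesis by (simp add: add_divide_distrib)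
  qed
  then show ?thesis using assms by (simp add: rate_def single_step_bound_def lg_def)
qed

lemma rate_2: "rate 2 = 1"
  by (simp add: rate_def single_step_bound_def lg_def)

lemma rate_mono:
  assumes "2 \<le> s" "s \<le> t"
  shows "rate s \<le> rate t"
proof -
  have mono: "rate a \<le> rate b" if "3 \<le> a" "a \<le> b" for a b
  proof -
    have "3 / (real b + 1) \<le> 3 / (real a + 1)" "4 / (real b + 1) \<le> 4 / (real a + 1)"
      using that by (intro divide_left_mono; simp)+
    moreover have "(1 - 4 / (real a + 1)) * log 2 (real a - 2) \<le> (1 - 4 / (real b + 1)) * log 2 (real b - 2)"
      using that calculation by (intro mult_mono) (auto simp: field_simps)
    ultimately show ?thesis using that by (simp add: rate_eq)
  qed
  show ?thesis
  proof (cases "s = 2")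
    case True
    have "1 \<le> rate 3" by (simp add: rate_def single_step_bound_def lg_def)
    then show ?thesis using mono[of 3 t] True assms rate_2 by (cases "t = 2") auto
  qed (use mono assms in auto)
qed

text \<open>The integer form of \<open>4 lg m \<le> 2 m + 3\<close>, for \<open>log_le_rate\<close>.\<close>

lemma fourth_power_le: "m \<ge> 1 \<Longrightarrow> (m :: nat) ^ 4 \<le> 2 ^ (2 * m + 3)"
proof (induction m rule: nat_induct_at_least)
  case (Suc m)
  show ?case
  proof (cases "m \<ge> 3")
    case True
    have "3 * Suc m \<le> 4 * m" using True by simp
    then have "(3 * Suc m) ^ 4 \<le> (4 * m) ^ 4" by (rule power_mono) simp
    then have "81 * (Suc m) ^ 4 \<le> 256 * m ^ 4" unfolding power_mult_distrib by simp
    then have "(Suc m) ^ 4 \<le> 4 * m ^ 4" by linarith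
    also have "\<dots> \<le> 4 * 2 ^ (2 * m + 3)" using Suc by simp
    finally show ?thesis by (simp add: power_add)
  next
    case False
    then have "m = 1 \<or> m = 2" using Suc by linarith
    then show ?thesis by (auto simp: numeral_eq_Suc)
  qed
qed simp

lemma log_le_rate:
  assumes "3 \<le> s"
  shows "log 2 (real s - 2) \<le> rate s"
proof -
  define m where "m = s - 2"
  have m: "m \<ge> 1" "real m = real s - 2" using assms by (auto simp: m_def)
  have "real m ^ 4 \<le> 2 ^ (2 * m + 3)" using fourth_power_le[OF m(1)] by (metis of_nat_le_iff of_nat_numeral of_nat_power)
  then have "log 2 (real m ^ 4) \<le> log 2 (2 ^ (2 * m + 3))" using m by (subst log_le_cancel_iff) auto
  then have "4 * log 2 (real m) \<le> 2 * real m + 3" using m by (simp add: log_nat_power)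
  then have "4 * log 2 (real s - 2) \<le> 2 * real s - 1" unfolding m by simp
  then show ?thesis using assms by (simp add: rate_def single_step_bound_def lg_def field_simps)
qed

text \<open>The number of queries that a tree with \<open>e\<close> edges and \<open>s\<close> colors may have consumed. It has gained two edges
  in exactly \<open>e - s\<close> steps, and each of these saved the price of an edge, which is at least
  \<open>edge_cost 4 = 3\<close> since the tree had three edges or more before that step.\<close>

definition tree_cost :: "nat \<Rightarrow> nat \<Rightarrow> real" where
  "tree_cost e s = total_cost e - 3 * (real e - real s)"

text \<open>Steps that gain two edges occur at three edges or later, and each step gains a color; hence a tree with
  \<open>s\<close> colors has at most \<open>2 s - 3\<close> edges unless \<open>e = s\<close>.\<close>

definition balanced :: "nat \<Rightarrow> nat \<Rightarrow> bool" where
  "balanced e s \<longleftrightarrow> 1 \<le> s \<and> s \<le> e \<and> (e = s \<or> e + 3 \<le> 2 * s)"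

text \<open>For \<open>e = s\<close> this is \<open>total_cost_le_single_step_bound\<close>. Every further edge adds \<open>edge_cost k - 3\<close> for
  some \<open>k\<close> with \<open>k - 1 \<le> 2 (s - 2)\<close>, hence at most \<open>lg (s - 2)\<close>, and this is no more than what its
  additional vertex may cost by \<open>log_le_rate\<close>.\<close>

lemma tree_cost_le_rate:
  assumes "balanced e s" "s \<le> t" "2 \<le> t"
  shows "tree_cost e s \<le> rate t * (real e + 1)"
proof (cases "s = 1")
  case True
  then have "e = 1" using assms by (auto simp: balanced_def)
  moreover have "1 \<le> rate t" using rate_mono[of 2 t] rate_2 assms by simp
  ultimately show ?thesis using True by (simp add: tree_cost_def total_cost_def edge_cost_def)
next
  case False
  then have s: "2 \<le> s" using assms by (auto simp: balanced_def)
  have *: "s + d = s \<or> s + d + 3 \<le> 2 * s \<Longrightarrow> tree_cost (s + d) s \<le> rate s * (real (s + d) + 1)" for d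
  proof (induction d)
    case 0
    have "tree_cost s s \<le> single_step_bound s" using total_cost_le_single_step_bound[OF s] by (simp add: tree_cost_def)
    also have "\<dots> = rate s * (real s + 1)" by (simp add: rate_def)
    finally show ?case by simp
  next
    case (Suc d)
    let ?e = "s + d"
    have le: "?e + 4 \<le> 2 * s" using Suc.prems by simp
    have "edge_cost ?e \<le> 2 + log 2 (real ?e - 1)" using s by (intro edge_cost_le_log) simp
    also have "\<dots> \<le> 2 + log 2 (2 * (real s - 2))"
    proof -
      have "real (?e + 4) \<le> real (2 * s)" using le by (simp only: of_nat_le_iff)
      then have "real ?e - 1 \<le> 2 * (real s - 2)" "0 < real ?e - 1" using s by simp_all
      then show ?thesis by simp
    qed
    also have "\<dots> = 3 + log 2 (real s - 2)" using le s by (subst log_mult) auto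
    also have "\<dots> \<le> 3 + rate s" using log_le_rate[of s] le by simp
    finally have "edge_cost ?e \<le> 3 + rate s" .
    moreover have "tree_cost ?e s \<le> rate s * (real ?e + 1)" using Suc by simp
    moreover have "tree_cost (Suc ?e) s = tree_cost ?e s + edge_cost ?e - 3"
      by (simp add: tree_cost_def total_cost_def)
    ultimately have "tree_cost (Suc ?e) s \<le> rate s * (real (Suc ?e) + 1)" by (simp add: algebra_simps)
    then show ?case by simp
  qed
  obtain d where "e = s + d" using assms(1) le_Suc_ex by (auto simp: balanced_def)
  then have "tree_cost e s \<le> rate s * (real e + 1)"
    using *[of d] assms(1) by (simp add: balanced_def)
  also have "\<dots> \<le> rate t * (real e + 1)" using rate_mono[OF s assms(2)] by (intro mult_right_mono) auto
  finally show ?thesis .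
qed

lemma tree_cost_step:
  assumes "balanced e s" "e' = e + 1 \<or> e' = e + 2 \<and> 3 \<le> e"
  shows "tree_cost e s + Suc (search_cost e) \<le> tree_cost e' (Suc s)" "balanced e' (Suc s)"
proof -
  have e: "e \<noteq> 0" using assms by (auto simp: balanced_def)
  have 1: "total_cost (e + 1) = total_cost e + Suc (search_cost e)"
    using e by (simp add: total_cost_def edge_cost_def)
  have 2: "total_cost (e + 2) = total_cost (e + 1) + Suc (search_cost (e + 1))"
    by (simp add: total_cost_def edge_cost_def numeral_2_eq_2)
  have "2 \<le> search_cost (e + 1)" if "3 \<le> e"
    using floorlog_mono[of 3 e 2] that by (simp add: search_cost_def compute_floorlog)
  then show "tree_cost e s + Suc (search_cost e) \<le> tree_cost e' (Suc s)"
    using assms(2) 1 2 by (auto simp: tree_cost_def)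
  show "balanced e' (Suc s)" using assms by (auto simp: balanced_def)
qed

section \<open>Merging an edge into a tree\<close>

lemma pair_in_nsets: "a \<in> A \<Longrightarrow> b \<in> A \<Longrightarrow> a \<noteq> b \<Longrightarrow> {a, b} \<in> nsets A 2"
  by (simp add: nsets_def)

lemma interior_neighbour:
  assumes "v \<in> interior A"
  obtains a where "a \<noteq> w" "{v, a} \<in> A"
proof -
  obtain a b where ab: "a \<noteq> b" "{v, a} \<in> A" "{v, b} \<in> A" using assms by (auto simp: interior_def)
  then show ?thesis using that[of a] that[of b] by (cases "a = w") auto
qed

text \<open>The region \<open>U\<close> is the part of the tree in which the search goes on. It is bounded by inner vertices \<open>b\<close> that
  have been queried already and point back into \<open>U\<close>: the answer was the color of the edge that leads from
  \<open>b\<close> into \<open>U\<close>. Querying the centroid \<open>u\<close> of \<open>U\<close>, weighted by inner vertices, either ends the search or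
  yields an arrow from \<open>u\<close> to an inner vertex \<open>v\<close> of \<open>U\<close>, and then the side of \<open>v\<close> is a region of at most
  half the weight that is bounded by \<open>u\<close> in addition. If the arrow leaves \<open>U\<close>, it meets an arrow in the
  opposite direction. The function \<open>z\<close> selects the partner of a vertex, \<open>x\<close> or \<open>y\<close>, according to its class in
  the bipartition \<open>p\<close>.\<close>

lemma piece_search:
  fixes p :: "nat \<Rightarrow> bool" and x y :: nat
  defines "z \<equiv> \<lambda>v. if p v then x else y"
  assumes P: "piece V F" and V: "V \<subseteq> {..<n}" and x: "x < n" "x \<notin> V" and y: "y < n" "y \<notin> V" and "x \<noteq> y"
    and c: "c \<notin> snd ` F" and p: "\<And>u v. {u, v} \<in> fst ` F \<Longrightarrow> p u \<noteq> p v"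
  shows "U \<subseteq> V \<Longrightarrow> tree U {e \<in> fst ` F. e \<subseteq> U} \<Longrightarrow> U \<inter> interior (fst ` F) \<noteq> {} \<Longrightarrow>
    F \<subseteq> E \<Longrightarrow> ({x, y}, c) \<in> E \<Longrightarrow>
    (\<And>a b i. ({a, b}, i) \<in> F \<Longrightarrow> a \<in> U \<Longrightarrow> b \<notin> U \<Longrightarrow>
      b \<in> interior (fst ` F) \<and> ({b, z b}, i) \<in> E) \<Longrightarrow>
    reach n t (\<lambda>m' E'. m' \<le> m + floorlog 2 (card (U \<inter> interior (fst ` F))) \<and> E \<subseteq> E' \<and>
      (\<exists>V' F'. grows V F x y V' F' \<and> F' \<subseteq> E')) m E"
proof (induction "card (U \<inter> interior (fst ` F))" arbitrary: U m E rule: less_induct)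
  case less
  let ?I = "interior (fst ` F)"
  let ?AU = "{e \<in> fst ` F. e \<subseteq> U}"
  let ?Q = "\<lambda>m' E'. m' \<le> m + floorlog 2 (card (U \<inter> ?I)) \<and> E \<subseteq> E' \<and>
      (\<exists>V' F'. grows V F x y V' F' \<and> F' \<subseteq> E')"
  note U = less.prems(1) and TU = less.prems(2) and ne = less.prems(3)
    and FE = less.prems(4) and xyE = less.prems(5) and boundary = less.prems(6)
  have finU: "finite U" using tree_basics(1)[OF TU] .
  have pos: "card (U \<inter> ?I) > 0" using ne finU by (simp add: card_gt_0_iff)
  have flog: "floorlog 2 (card (U \<inter> ?I)) = Suc (floorlog 2 (card (U \<inter> ?I) div 2))"
    using pos by (subst compute_floorlog) simp
  have "w = w'" if "v \<in> U - ?I" "{v, w} \<in> ?AU" "{v, w'} \<in> ?AU" for v w w'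
    using that unfolding interior_def by blast
  then obtain u where u: "u \<in> U \<inter> ?I"
    and halves: "\<And>v. {u, v} \<in> ?AU \<Longrightarrow> \<exists>W. cut_off U ?AU u v W \<and> 2 * card (W \<inter> ?I) \<le> card (U \<inter> ?I)"
    using tree_centroid[OF TU ne] by blast
  have uV: "u \<in> V" using u U by auto
  have zu: "z u \<notin> V" "z u < n" using x y by (auto simp: z_def)
  obtain z' where z': "{z u, z'} = {x, y}" "z' \<notin> V" "z u \<noteq> z'"
    using x y \<open>x \<noteq> y\<close> that by (cases "p u") (auto simp: z_def insert_commute)
  have grows_z: "grows V F x y V' F'" if "grows V F (z u) z' V' F'" for V' F'
    using that z'(1) grows_commute[of V F x y] by (auto simp: doubleton_eq_iff)
  have "{u, z u} \<in> nsets {..<n} 2"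
    using uV V zu by (intro pair_in_nsets) auto
  then show ?case
  proof (rule reach.query)
    fix i assume "i \<in> {1..t}"
    let ?E = "insert ({u, z u}, i) E"
    have finish: "reach n t ?Q (Suc m) ?E" if "grows V F (z u) z' V' F'" "F' \<subseteq> ?E" for V' F'
      using grows_z[OF that(1)] that(2) flog by (intro reach.stop) auto
    have zc: "({z u, z'}, c) \<in> ?E" using xyE z'(1) by simp
    show "reach n t ?Q (Suc m) ?E"
    proof (cases "i \<in> snd ` F \<and> (\<exists>v. ({u, v}, i) \<in> F)")
      case False
      show ?thesis
      proof (cases "i \<in> snd ` F")
        case True
        then have "grows V F (z u) z' (insert z' (insert (z u) V))
            (insert ({z u, z'}, c) (insert ({u, z u}, i) F))"
          using False u by (intro grows_double[OF P zu(1) z'(2,3) c]) auto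
        then show ?thesis by (rule finish) (use FE zc in auto)
      next
        case False
        have "grows V F (z u) z' (insert (z u) V) (insert ({u, z u}, i) F)"
          by (rule grows_new_color[OF P uV zu(1) False])
        then show ?thesis by (rule finish) (use FE in auto)
      qed
    next
      case True
      then obtain v where v: "({u, v}, i) \<in> F" by blast
      have vV: "v \<in> V" "{u, v} \<in> fst ` F" using piece_edge[OF P v] by auto
      consider "v \<notin> U" | "v \<notin> ?I" | "v \<in> U" "v \<in> ?I" by blast
      then show ?thesis
      proof cases
        case 1
        have vE: "({v, z v}, i) \<in> E" using boundary[OF v _ 1] u by simp
        have "z v = z'" using p[OF vV(2)] z'(1) \<open>x \<noteq> y\<close>
          by (auto simp: z_def doubleton_eq_iff split: if_splits)
        \<comment> \<open>Both ends of uv have a further neighbor, and a tree has no triangle.\<close>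
        have "3 \<le> card F"
        proof -
          have "v \<in> ?I" using boundary[OF v _ 1] u by simp
          then obtain b where b: "b \<noteq> u" "{v, b} \<in> fst ` F" by (rule interior_neighbour)
          have "u \<in> ?I" using u by simp
          then obtain a where a: "a \<noteq> v" "{u, a} \<in> fst ` F" by (rule interior_neighbour)
          note ab = a b
          have "p u \<noteq> p v" "p u \<noteq> p a" "p v \<noteq> p b" using p[OF vV(2)] p[OF a(2)] p[OF b(2)] by auto
          then have "{u, v} \<noteq> {u, a}" "{u, v} \<noteq> {v, b}" "{u, a} \<noteq> {v, b}"
            using a(1) b(1) by (auto simp: doubleton_eq_iff)
          then have "card {{u, v}, {u, a}, {v, b}} = 3" by simp
          moreover have "{{u, v}, {u, a}, {v, b}} \<subseteq> fst ` F" using vV ab by blast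
          ultimately have "3 \<le> card (fst ` F)"
            using card_mono[OF tree_basics(3)[OF piece_tree[OF P]]] by metis
          then show ?thesis using card_image[of fst F] P by (simp add: piece_def)
        qed
        then have "grows V F (z u) z' (insert (z u) (insert z' V))
            (F - {({u, v}, i)} \<union> {({u, z u}, i), ({z u, z'}, c), ({z', v}, i)})"
          by (rule grows_subdivide[OF P zu(1) z'(2,3) c v])
        moreover have "({z', v}, i) \<in> ?E" using vE \<open>z v = z'\<close> by (simp add: insert_commute)
        ultimately show ?thesis by (intro finish) (use FE zc in auto)
      next
        case 2
        have "grows V F (z u) z' (insert z' (insert (z u) (V - {v})))
            (insert ({z u, z'}, c) (insert ({u, z u}, i) (F - {({u, v}, i)})))"
          by (rule grows_drop_leaf[OF P zu(1) z'(2,3) c v 2])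
        then show ?thesis by (rule finish) (use FE zc in auto)
      next
        case 3
        then have "{u, v} \<in> ?AU" using vV u by auto
        then obtain W where W: "cut_off U ?AU u v W" and half: "2 * card (W \<inter> ?I) \<le> card (U \<inter> ?I)"
          using halves by blast
        have WU: "W \<subseteq> U" "v \<in> W" "u \<notin> W" using W by (auto simp: cut_off_def)
        have sub: "{e \<in> ?AU. e \<subseteq> W} = {e \<in> fst ` F. e \<subseteq> W}" using WU(1) by blast
        have R: "reach n t (\<lambda>m' E'. m' \<le> Suc m + floorlog 2 (card (W \<inter> ?I)) \<and> ?E \<subseteq> E' \<and>
            (\<exists>V' F'. grows V F x y V' F' \<and> F' \<subseteq> E')) (Suc m) ?E"
        proof (rule less.hyps)
          show "card (W \<inter> ?I) < card (U \<inter> ?I)" using half pos by linarith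
          show "W \<subseteq> V" using WU U by blast
          show "tree W {e \<in> fst ` F. e \<subseteq> W}" using W sub by (simp add: cut_off_def)
          show "W \<inter> ?I \<noteq> {}" using WU 3 by blast
          show "F \<subseteq> ?E" "({x, y}, c) \<in> ?E" using FE xyE by auto
          show "b \<in> ?I \<and> ({b, z b}, k) \<in> ?E" if ab: "({a, b}, k) \<in> F" "a \<in> W" "b \<notin> W" for a b k
          proof (cases "b \<in> U")
            case True
            have "{a, b} \<in> ?AU" using piece_edge(1)[OF P ab(1)] ab(2) WU(1) True by blast
            then have "a = v" "b = u" using W ab(2,3) unfolding cut_off_def by blast+
            moreover from this have "k = i" using piece_color_unique[OF P v] ab(1) by (simp add: insert_commute)
            ultimately show ?thesis using u by simp
          next
            case False
            then show ?thesis using boundary[OF ab(1) _ False] ab(2) WU(1) by blast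
          qed
        qed
        have "floorlog 2 (card (W \<inter> ?I)) \<le> floorlog 2 (card (U \<inter> ?I) div 2)"
          using half by (intro floorlog_mono) linarith
        then show ?thesis using flog by (intro reach_mono[OF R]) auto
      qed
    qed
  qed
qed

text \<open>The search starts with the whole tree as its region. A single edge has no inner vertex, but both its
  ends are leaves, so one query is enough.\<close>

lemma piece_merge:
  assumes P: "piece V F" and V: "V \<subseteq> {..<n}" "2 \<le> card V"
    and x: "x < n" "x \<notin> V" and y: "y < n" "y \<notin> V" and "x \<noteq> y"
    and c: "c \<notin> snd ` F" and E: "F \<subseteq> E" "({x, y}, c) \<in> E"
  shows "reach n t (\<lambda>m' E'. m' \<le> m + search_cost (card F) \<and> E \<subseteq> E' \<and>
      (\<exists>V' F'. grows V F x y V' F' \<and> F' \<subseteq> E')) m E"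
proof (cases "3 \<le> card V")
  case True
  have T: "tree V (fst ` F)" by (rule piece_tree[OF P])
  obtain p :: "nat \<Rightarrow> bool" where p: "\<And>u v. {u, v} \<in> fst ` F \<Longrightarrow> p u \<noteq> p v"
    using tree_bipartite[OF T] by blast
  have all: "{e \<in> fst ` F. e \<subseteq> V} = fst ` F" using tree_basics(4)[OF T] by blast
  have I: "V \<inter> interior (fst ` F) = interior (fst ` F)" using interior_subset[OF T] by blast
  have R: "reach n t (\<lambda>m' E'. m' \<le> m + floorlog 2 (card (V \<inter> interior (fst ` F))) \<and> E \<subseteq> E' \<and>
      (\<exists>V' F'. grows V F x y V' F' \<and> F' \<subseteq> E')) m E"
  proof (rule piece_search[OF P V(1) x y \<open>x \<noteq> y\<close> c p])
    show "tree V {e \<in> fst ` F. e \<subseteq> V}" using T by (simp add: all)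
    show "V \<inter> interior (fst ` F) \<noteq> {}" using card_interior(1)[OF T True] I by simp
    show "b \<in> interior (fst ` F) \<and> ({b, if p b then x else y}, i) \<in> E" if "({a, b}, i) \<in> F" "a \<in> V" "b \<notin> V" for a b i
      using piece_edge(3)[OF P that(1)] that(3) by simp
  qed (use E in auto)
  have "card (V \<inter> interior (fst ` F)) \<le> card F - 1"
    using card_interior(2)[OF T True] piece_card[OF P] I by simp
  then have "floorlog 2 (card (V \<inter> interior (fst ` F))) \<le> search_cost (card F)"
    using floorlog_mono[of "card (V \<inter> interior (fst ` F))" "card F - 1" 2] by (simp add: search_cost_def)
  then show ?thesis by (intro reach_mono[OF R]) auto
next
  case False
  then have "card F = 1" using piece_card[OF P] V(2) by simp
  then obtain e k where Fe: "F = {(e, k)}" by (metis card_1_singletonE surj_pair)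
  then have "card e = 2" "e \<subseteq> V" using tree_basics(4)[OF piece_tree[OF P], of e] by auto
  then obtain u v where uv: "e = {u, v}" "u \<noteq> v" by (auto simp: card_2_iff)
  have uV: "u \<in> V" using \<open>e \<subseteq> V\<close> uv by simp
  have leaf: "v \<notin> interior (fst ` F)" using uv by (auto simp: Fe interior_def doubleton_eq_iff)
  have cost: "1 \<le> search_cost (card F)" by (simp add: search_cost_def)
  have "{u, x} \<in> nsets {..<n} 2" using uV V x by (intro pair_in_nsets) auto
  then show ?thesis
  proof (rule reach.query)
    fix i assume "i \<in> {1..t}"
    let ?E = "insert ({u, x}, i) E"
    have "\<exists>V' F'. grows V F x y V' F' \<and> F' \<subseteq> ?E"
    proof (cases "i = k")
      case True
      then have "({u, v}, i) \<in> F" by (simp add: Fe uv)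
      from grows_drop_leaf[OF P x(2) y(2) \<open>x \<noteq> y\<close> c this leaf] E show ?thesis by blast
    next
      case False
      then have "i \<notin> snd ` F" by (simp add: Fe)
      from grows_new_color[OF P uV x(2) this] E show ?thesis by blast
    qed
    then show "reach n t (\<lambda>m' E'. m' \<le> m + search_cost (card F) \<and> E \<subseteq> E' \<and>
      (\<exists>V' F'. grows V F x y V' F' \<and> F' \<subseteq> E')) (Suc m) ?E"
      using cost by (intro reach.stop) auto
  qed
qed

section \<open>Arrangements of disjoint trees\<close>

text \<open>Builder's position: disjoint exposed trees with a common color. The common color is required to exist
  even if there are no trees yet.\<close>

definition arrangement :: "nat \<Rightarrow> nat \<Rightarrow> colored_edges \<Rightarrow> (nat set \<times> colored_edges) set \<Rightarrow> bool" where
  "arrangement n t E \<T> \<longleftrightarrow> E \<subseteq> nsets {..<n} 2 \<times> {1..t} \<and> finite \<T> \<and>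
     (\<forall>T\<in>\<T>. piece (fst T) (snd T) \<and> fst T \<subseteq> {..<n} \<and> snd T \<subseteq> E \<and>
       balanced (card (snd T)) (card (snd ` snd T))) \<and>
     disjoint_family_on fst \<T> \<and> (\<exists>j\<in>{1..t}. \<forall>T\<in>\<T>. j \<in> snd ` snd T)"

definition covered :: "(nat set \<times> colored_edges) set \<Rightarrow> nat set" where
  "covered \<T> = \<Union> (fst ` \<T>)"

definition cost :: "(nat set \<times> colored_edges) set \<Rightarrow> real" where
  "cost \<T> = (\<Sum>T\<in>\<T>. tree_cost (card (snd T)) (card (snd ` snd T)))"

definition color_total :: "(nat set \<times> colored_edges) set \<Rightarrow> nat" where
  "color_total \<T> = (\<Sum>T\<in>\<T>. card (snd ` snd T))"

lemma arrangementD: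
  assumes "arrangement n t E \<T>"
  shows "E \<subseteq> nsets {..<n} 2 \<times> {1..t}" "finite \<T>"
    "\<And>T. T \<in> \<T> \<Longrightarrow> piece (fst T) (snd T)" "\<And>T. T \<in> \<T> \<Longrightarrow> fst T \<subseteq> {..<n}"
    "\<And>T. T \<in> \<T> \<Longrightarrow> snd T \<subseteq> E"
    "\<And>T. T \<in> \<T> \<Longrightarrow> balanced (card (snd T)) (card (snd ` snd T))"
    "disjoint_family_on fst \<T>"
  using assms by (simp_all add: arrangement_def)

lemma card_covered:
  assumes "arrangement n t E \<T>"
  shows "card (covered \<T>) = (\<Sum>T\<in>\<T>. Suc (card (snd T)))" "covered \<T> \<subseteq> {..<n}"
proof -
  note A = arrangementD[OF assms]
  have "card (covered \<T>) = (\<Sum>T\<in>\<T>. card (fst T))"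
    unfolding covered_def using A(2,7) piece_finite(1)[OF A(3)]
    by (intro card_UN_disjoint') auto
  also have "\<dots> = (\<Sum>T\<in>\<T>. Suc (card (snd T)))"
    using piece_card[OF A(3)] by (intro sum.cong) auto
  finally show "card (covered \<T>) = (\<Sum>T\<in>\<T>. Suc (card (snd T)))" .
  show "covered \<T> \<subseteq> {..<n}" using A(4) by (auto simp: covered_def)
qed

lemma color_total_le:
  assumes "arrangement n t E \<T>"
  shows "color_total \<T> \<le> n"
proof -
  note A = arrangementD[OF assms]
  have "color_total \<T> \<le> (\<Sum>T\<in>\<T>. Suc (card (snd T)))"
    unfolding color_total_def
    by (intro sum_mono le_SucI card_image_le piece_finite(2)[OF A(3)])
  also have "\<dots> \<le> n" using card_covered[OF assms] card_mono[of "{..<n}" "covered \<T>"] by simp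
  finally show ?thesis .
qed

lemma cost_le:
  assumes "arrangement n t E \<T>" "2 \<le> t"
  shows "cost \<T> \<le> rate t * real n"
proof -
  note A = arrangementD[OF assms(1)]
  have "1 \<le> rate t" using rate_mono[of 2 t] rate_2 assms(2) by simp
  have "cost \<T> \<le> (\<Sum>T\<in>\<T>. rate t * (real (card (snd T)) + 1))"
    unfolding cost_def
  proof (intro sum_mono tree_cost_le_rate A(6) assms(2))
    fix T assume T: "T \<in> \<T>"
    have "snd ` snd T \<subseteq> {1..t}" using A(1) A(5)[OF T] by auto
    then show "card (snd ` snd T) \<le> t" using card_mono[of "{1..t}"] by fastforce
  qed
  also have "\<dots> = rate t * real (card (covered \<T>))"
    unfolding card_covered(1)[OF assms(1)] by (simp add: sum_distrib_left add.commute)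
  also have "\<dots> \<le> rate t * real n"
    using card_covered(2)[OF assms(1)] card_mono[of "{..<n}" "covered \<T>"] \<open>1 \<le> rate t\<close>
    by (intro mult_left_mono) auto
  finally show ?thesis .
qed

lemma arrangement_insert:
  assumes A: "arrangement n t E \<T>" and \<U>: "\<U> \<subseteq> \<T>" and E': "E \<subseteq> E'" "E' \<subseteq> nsets {..<n} 2 \<times> {1..t}"
    and P: "piece V F" "V \<subseteq> {..<n}" "F \<subseteq> E'" "balanced (card F) (card (snd ` F))"
    and disj: "V \<inter> covered \<U> = {}" and j: "j \<in> {1..t}" "\<And>T. T \<in> \<U> \<Longrightarrow> j \<in> snd ` snd T" "j \<in> snd ` F"
  shows "arrangement n t E' (insert (V, F) \<U>)"
    "cost (insert (V, F) \<U>) = tree_cost (card F) (card (snd ` F)) + cost \<U>"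
    "color_total (insert (V, F) \<U>) = card (snd ` F) + color_total \<U>"
proof -
  note AD = arrangementD[OF A]
  have fin: "finite \<U>" using AD(2) \<U> finite_subset by blast
  have sep: "V \<inter> fst T = {}" if "T \<in> \<U>" for T using disj that by (auto simp: covered_def)
  have new: "(V, F) \<notin> \<U>" using sep[of "(V, F)"] piece_finite(3)[OF P(1)] by auto
  have "disjoint_family_on fst \<U>" using AD(7) \<U> by (rule disjoint_family_on_mono[rotated])
  then have "disjoint_family_on fst (insert (V, F) \<U>)"
    using sep by (subst disjoint_family_on_insert[OF new]) (auto simp: covered_def)
  moreover have "\<forall>T\<in>insert (V, F) \<U>. piece (fst T) (snd T) \<and> fst T \<subseteq> {..<n} \<and> snd T \<subseteq> E' \<and>
       balanced (card (snd T)) (card (snd ` snd T))"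
  proof
    fix T assume "T \<in> insert (V, F) \<U>"
    then consider "T = (V, F)" | "T \<in> \<T>" using \<U> by blast
    then show "piece (fst T) (snd T) \<and> fst T \<subseteq> {..<n} \<and> snd T \<subseteq> E' \<and>
       balanced (card (snd T)) (card (snd ` snd T))"
    proof cases
      case 2
      then show ?thesis using AD(3-6)[of T] E'(1) by simp
    qed (use P in simp)
  qed
  moreover have "\<forall>T\<in>insert (V, F) \<U>. j \<in> snd ` snd T" using j(2,3) by simp
  ultimately show "arrangement n t E' (insert (V, F) \<U>)"
    unfolding arrangement_def using E'(2) fin j(1) by blast
  show "cost (insert (V, F) \<U>) = tree_cost (card F) (card (snd ` F)) + cost \<U>"
    "color_total (insert (V, F) \<U>) = card (snd ` F) + color_total \<U>"
    using fin new by (simp_all add: cost_def color_total_def)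
qed

text \<open>The main loop of the strategy. The invariant says that the queries made so far are paid for by the trees
  present; uncovered vertices, including leaves that were given up, carry no credit. The total number of
  colors is bounded by \<open>n\<close> and increases in each round.\<close>

lemma reach_arrangement:
  assumes "arrangement n t E \<T>" "real m \<le> cost \<T>"
  shows "reach n t (\<lambda>m' E'. \<exists>\<T>'. arrangement n t E' \<T>' \<and> real m' \<le> cost \<T>' \<and>
    card ({..<n} - covered \<T>') \<le> 1) m E"
  using assms
proof (induction "n - color_total \<T>" arbitrary: \<T> m E rule: less_induct)
  case less
  let ?Q = "\<lambda>m' E'. \<exists>\<T>'. arrangement n t E' \<T>' \<and> real m' \<le> cost \<T>' \<and> card ({..<n} - covered \<T>') \<le> 1"
  note A = less.prems(1) and AD = arrangementD[OF less.prems(1)]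
  show ?case
  proof (cases "card ({..<n} - covered \<T>) \<le> 1")
    case True
    then show ?thesis using less.prems by (intro reach.stop) blast
  next
    case False
    then have "\<not> (\<exists>x. {..<n} - covered \<T> \<subseteq> {x})"
      by (metis card.empty card_mono finite.emptyI finite.insertI card_insert_disjoint empty_iff One_nat_def)
    then obtain x y where xy: "x < n" "y < n" "x \<notin> covered \<T>" "y \<notin> covered \<T>" "x \<noteq> y" by blast
    have progress: "reach n t ?Q m' E'"
      if "arrangement n t E' \<T>'" "real m' \<le> cost \<T>'" "color_total \<T>' = Suc (color_total \<T>)" for m' E' \<T>'
      using color_total_le[OF that(1)] that by (intro less.hyps[of \<T>']) auto
    have "{x, y} \<in> nsets {..<n} 2" using xy by (intro pair_in_nsets) auto
    then show ?thesis
    proof (rule reach.query)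
      fix c assume c: "c \<in> {1..t}"
      let ?E = "insert ({x, y}, c) E"
      have legal: "?E \<subseteq> nsets {..<n} 2 \<times> {1..t}" using AD(1) c xy by (auto intro: pair_in_nsets)
      show "reach n t ?Q (Suc m) ?E"
      \<comment> \<open>If c occurs in all trees, the common color may change to c.\<close>
      proof (cases "\<forall>T\<in>\<T>. c \<in> snd ` snd T")
        case True
        let ?V = "{x, y}" and ?F = "{({x, y}, c)}"
        have "arrangement n t ?E (insert (?V, ?F) \<T>)"
          "cost (insert (?V, ?F) \<T>) = tree_cost (card ?F) (card (snd ` ?F)) + cost \<T>"
          "color_total (insert (?V, ?F) \<T>) = card (snd ` ?F) + color_total \<T>"
          using arrangement_insert[OF A subset_refl _ legal piece_single_edge[OF xy(5)] _ _ _ _ c, of c] xy True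
          by (auto simp: balanced_def)
        moreover have "tree_cost 1 1 = 1" by (simp add: tree_cost_def total_cost_def edge_cost_def)
        ultimately show ?thesis using less.prems(2) by (intro progress) simp_all
      next
        case False
        then obtain V F where T: "(V, F) \<in> \<T>" and cF: "c \<notin> snd ` F" by force
        have P: "piece V F" "V \<subseteq> {..<n}" "F \<subseteq> E" "balanced (card F) (card (snd ` F))"
          using AD(3-6)[OF T] by simp_all
        have out: "x \<notin> V" "y \<notin> V" using xy(3,4) T by (auto simp: covered_def)
        have "2 \<le> card V" using piece_card[OF P(1)] P(4) by (simp add: balanced_def)
        then have "reach n t (\<lambda>m' E'. m' \<le> Suc m + search_cost (card F) \<and> ?E \<subseteq> E' \<and>
            (\<exists>V' F'. grows V F x y V' F' \<and> F' \<subseteq> E')) (Suc m) ?E"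
          using P(3) by (intro piece_merge[OF P(1,2) _ xy(1) out(1) xy(2) out(2) xy(5) cF]) auto
        then show ?thesis
        proof (rule reach_trans[OF reach_legal[OF _ legal]], elim conjE exE)
          fix m' E' V' F'
          assume m': "m' \<le> Suc m + search_cost (card F)" and E': "?E \<subseteq> E'" "E' \<subseteq> nsets {..<n} 2 \<times> {1..t}"
            and g: "grows V F x y V' F'" and F': "F' \<subseteq> E'"
          let ?\<U> = "\<T> - {(V, F)}"
          have sum: "cost \<T> = tree_cost (card F) (card (snd ` F)) + cost ?\<U>"
            "color_total \<T> = card (snd ` F) + color_total ?\<U>"
            unfolding cost_def color_total_def by (simp_all add: sum.remove[OF AD(2) T])
          have g': "piece V' F'" "V' \<subseteq> insert x (insert y V)" "snd ` F \<subseteq> snd ` F'"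
            "card (snd ` F') = Suc (card (snd ` F))" "card F' = card F + 1 \<or> card F' = card F + 2 \<and> 3 \<le> card F"
            using g by (simp_all add: grows_def)
          obtain j where j: "j \<in> {1..t}" "\<And>T. T \<in> \<T> \<Longrightarrow> j \<in> snd ` snd T"
            using A unfolding arrangement_def by blast
          have "V \<inter> covered ?\<U> = {}"
            using AD(7) T unfolding covered_def disjoint_family_on_def by fastforce
          moreover have "covered ?\<U> \<subseteq> covered \<T>" by (auto simp: covered_def)
          ultimately have disj: "V' \<inter> covered ?\<U> = {}" using g'(2) xy by blast
          note step = tree_cost_step[OF P(4) g'(5)]
          have V': "V' \<subseteq> {..<n}" and EE': "E \<subseteq> E'" using g'(2) P(2) xy E'(1) by auto
          have bal: "balanced (card F') (card (snd ` F'))" using step(2) g'(4) by simp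
          have jF': "j \<in> snd ` F'" using j(2)[OF T] g'(3) by auto
          have jU: "j \<in> snd ` snd T" if "T \<in> ?\<U>" for T using j(2) that by blast
          note new = arrangement_insert[OF A Diff_subset EE' E'(2) g'(1) V' F' bal disj j(1) jU jF']
          show "reach n t ?Q m' E'"
          proof (rule progress[OF new(1)])
            show "real m' \<le> cost (insert (V', F') ?\<U>)"
            proof -
              have "real m' \<le> real m + real (Suc (search_cost (card F)))" using m' by linarith
              also have "\<dots> \<le> tree_cost (card F') (card (snd ` F')) + cost ?\<U>"
                using sum(1) step(1) less.prems(2) unfolding g'(4) by linarith
              finally show ?thesis using new(2) by simp
            qed
            show "color_total (insert (V', F') ?\<U>) = Suc (color_total \<T>)"
              using new(3) sum(2) g'(4) by simp
          qed
        qed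
      qed
    qed
  qed
qed


section \<open>Winning and the bound\<close>

text \<open>The certificate. With \<open>G\<close> the union of the trees, the color classes \<open>M i\<close> are matchings with
  \<open>\<Sum>\<^sub>i card (M i) = card G\<close>; the number of covered vertices is \<open>card G + card \<T>\<close>, and the common color
  \<open>j\<close> has an edge in each tree, so \<open>card \<T> \<le> card (M j)\<close>. If Builder had not won, \<open>n\<close> would be too
  small.\<close>

lemma arrangement_wins:
  fixes r :: "nat \<Rightarrow> nat"
  assumes A: "arrangement n t E \<T>" and unc: "card ({..<n} - covered \<T>) \<le> 1"
    and pos: "\<And>i. i \<in> {1..t} \<Longrightarrow> r i > 0"
    and big: "\<And>j. j \<in> {1..t} \<Longrightarrow> (\<Sum>i=1..t. r i - 1) + r j < n"
  shows "wins t (\<lambda>i. matching_graph (r i)) n E"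
proof (rule ccontr)
  assume lose: "\<not> ?thesis"
  note AD = arrangementD[OF A]
  define G where "G = \<Union> (snd ` \<T>)"
  define M where "M i = {e. (e, i) \<in> G}" for i
  have finG: "finite G" using AD(2) piece_finite(2)[OF AD(3)] by (auto simp: G_def)
  have GE: "G \<subseteq> E" using AD(5) by (auto simp: G_def)
  have Gcol: "snd ` G \<subseteq> {1..t}" using GE AD(1) by auto
  have M_img: "M i = fst ` {p \<in> G. snd p = i}" for i by (force simp: M_def)
  have cardM: "card (M i) = card {p \<in> G. snd p = i}" for i
    unfolding M_img by (intro card_image) (auto simp: inj_on_def)
  have finM: "finite (M i)" for i unfolding M_img using finG by simp
  have sumM: "(\<Sum>i=1..t. card (M i)) = card G"
    unfolding cardM using sum.group[OF finG _ Gcol, of "\<lambda>_. 1 :: nat"] by simp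
  have disjM: "disjoint (M i)" for i
  proof (rule disjointI)
    fix d e assume "d \<in> M i" "e \<in> M i" "d \<noteq> e"
    then obtain S T where ST: "S \<in> \<T>" "T \<in> \<T>" "(d, i) \<in> snd S" "(e, i) \<in> snd T"
      by (auto simp: M_def G_def)
    show "d \<inter> e = {}"
    proof (cases "S = T")
      case True
      then show ?thesis using piece_proper[OF AD(3)[OF ST(1)] ST(3)] ST(4) \<open>d \<noteq> e\<close> by blast
    next
      case False
      then have "fst S \<inter> fst T = {}" using AD(7) ST(1,2) by (auto simp: disjoint_family_on_def)
      then show ?thesis
        using piece_subset[OF AD(3)[OF ST(1)] ST(3)] piece_subset[OF AD(3)[OF ST(2)] ST(4)] by blast
    qed
  qed
  have small: "card (M i) \<le> r i - 1" if i: "i \<in> {1..t}" for i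
  proof (rule ccontr)
    assume "\<not> ?thesis"
    then have "r i \<le> card (M i)" by simp
    then obtain M' where M': "M' \<subseteq> M i" "card M' = r i"
      using obtain_subset_with_card_n by blast
    have "{e. (e, i) \<in> E} \<subseteq> nsets {..<n} 2" using AD(1) by auto
    moreover have "M' \<subseteq> {e. (e, i) \<in> E}" using M'(1) GE by (auto simp: M_def)
    moreover have "disjoint M'" using disjM M'(1) by (rule pairwise_subset)
    moreover have "finite M'" using M'(1) finM finite_subset by blast
    ultimately have "contains_copy ({..<n}, {e. (e, i) \<in> E}) (matching_graph (r i))"
      using M'(2) by (subst contains_matching_iff) auto
    then show False using lose i by (auto simp: wins_def)
  qed
  have apart: "snd S \<inter> snd T = {}" if "S \<in> \<T>" "T \<in> \<T>" "S \<noteq> T" for S T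
  proof (rule ccontr)
    assume "snd S \<inter> snd T \<noteq> {}"
    then obtain e i where e: "(e, i) \<in> snd S" "(e, i) \<in> snd T" by auto
    have "e \<subseteq> fst S \<inter> fst T"
      using piece_subset[OF AD(3)[OF that(1)] e(1)] piece_subset[OF AD(3)[OF that(2)] e(2)] by blast
    moreover have "fst S \<inter> fst T = {}" using AD(7) that by (auto simp: disjoint_family_on_def)
    moreover have "card e = 2" using tree_basics(4)[OF piece_tree[OF AD(3)[OF that(1)]], of e] e(1) by force
    ultimately show False by auto
  qed
  have cardG: "card G = (\<Sum>T\<in>\<T>. card (snd T))"
    unfolding G_def using AD(2) piece_finite(2)[OF AD(3)] apart
    by (intro card_UN_disjoint) auto
  obtain j where j: "j \<in> {1..t}" "\<And>T. T \<in> \<T> \<Longrightarrow> j \<in> snd ` snd T"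
    using A unfolding arrangement_def by blast
  have "\<forall>T\<in>\<T>. \<exists>e. (e, j) \<in> snd T" using j(2) by force
  then obtain h where h: "\<And>T. T \<in> \<T> \<Longrightarrow> (h T, j) \<in> snd T" by metis
  have "card \<T> \<le> card (M j)"
  proof (rule card_inj_on_le)
    show "inj_on h \<T>"
    proof
      fix S T assume "S \<in> \<T>" "T \<in> \<T>" "h S = h T"
      then show "S = T" using apart[of S T] h[of S] h[of T] by auto
    qed
    show "h ` \<T> \<subseteq> M j" using h by (auto simp: M_def G_def)
  qed (rule finM)
  have "n \<le> card (covered \<T>) + card ({..<n} - covered \<T>)"
    using card_mono[of "covered \<T> \<union> ({..<n} - covered \<T>)" "{..<n}"] finite_subset[OF card_covered(2)[OF A]]
      card_Un_le[of "covered \<T>" "{..<n} - covered \<T>"] by force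
  also have "card (covered \<T>) = card G + card \<T>"
    using card_covered(1)[OF A] cardG by (simp add: sum_Suc)
  finally have "n \<le> (\<Sum>i=1..t. card (M i)) + card (M j) + 1"
    using sumM \<open>card \<T> \<le> card (M j)\<close> unc by linarith
  also have "(\<Sum>i=1..t. card (M i)) \<le> (\<Sum>i=1..t. r i - 1)" by (intro sum_mono small)
  finally show False using small[OF j(1)] big[OF j(1)] pos[OF j(1)] by linarith
qed

lemma winning_strategy_exists:
  fixes r :: "nat \<Rightarrow> nat"
  assumes t: "2 \<le> t" and pos: "\<And>i. i \<in> {1..t} \<Longrightarrow> r i > 0"
    and big: "\<And>j. j \<in> {1..t} \<Longrightarrow> (\<Sum>i=1..t. r i - 1) + r j < n"
  shows "\<exists>\<sigma>. winning_strategy t (\<lambda>i. matching_graph (r i)) n (nat \<lfloor>rate t * real n\<rfloor>) \<sigma>"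
proof (rule reach_winning_strategy)
  have "arrangement n t {} {}" using t by (auto simp: arrangement_def disjoint_family_on_def)
  moreover have "real 0 \<le> cost {}" by (simp add: cost_def)
  ultimately have "reach n t (\<lambda>m E. \<exists>\<T>. arrangement n t E \<T> \<and> real m \<le> cost \<T> \<and>
      card ({..<n} - covered \<T>) \<le> 1) 0 {}"
    by (rule reach_arrangement)
  then show "reach n t (\<lambda>m E. m \<le> nat \<lfloor>rate t * real n\<rfloor> \<and> wins t (\<lambda>i. matching_graph (r i)) n E) 0 {}"
  proof (rule reach_mono, elim exE conjE, intro conjI)
    fix m E \<T> assume A: "arrangement n t E \<T>" and m: "real m \<le> cost \<T>" and unc: "card ({..<n} - covered \<T>) \<le> 1"
    have "real m \<le> rate t * real n" using m cost_le[OF A t] by linarith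
    then show "m \<le> nat \<lfloor>rate t * real n\<rfloor>" by linarith
    show "wins t (\<lambda>i. matching_graph (r i)) n E" by (rule arrangement_wins[OF A unc pos big])
  qed
qed (use t in simp)

lemma set_play: "(e, i) \<in> set (play \<sigma> \<chi> k) \<Longrightarrow> i = \<chi> e \<and> (\<exists>j<k. e = \<sigma> (play \<sigma> \<chi> j))"
  by (induction k) (auto simp: Let_def less_Suc_eq)

lemma contains_copy_mono:
  assumes "contains_copy (U, B) G" "B \<subseteq> B'"
  shows "contains_copy (U, B') G"
proof -
  obtain f where "inj_on f (fst G)" "f ` fst G \<subseteq> U" "\<forall>e\<in>snd G. f ` e \<in> B"
    using assms(1) by (auto simp: contains_copy_def)
  with assms(2) show ?thesis
    unfolding contains_copy_def by (intro exI[of _ f]) auto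
qed

lemma winning_strategy_forces_copy:
  assumes "winning_strategy t G n l \<sigma>" "\<chi> \<in> edge_colorings t n"
  shows "\<exists>i\<in>{1..t}. contains_copy ({..<n}, {e \<in> snd (complete_graph n). \<chi> e = i}) (G i)"
proof -
  obtain k where k: "\<forall>j<k. \<sigma> (play \<sigma> \<chi> j) \<in> snd (complete_graph n)" "builder_wins t G n (play \<sigma> \<chi> k)"
    using assms by (auto simp: winning_strategy_def)
  then obtain i where i: "i \<in> {1..t}" "contains_copy ({..<n}, {e. (e, i) \<in> set (play \<sigma> \<chi> k)}) (G i)"
    by (auto simp: builder_wins_def)
  have "{e. (e, i) \<in> set (play \<sigma> \<chi> k)} \<subseteq> {e \<in> snd (complete_graph n). \<chi> e = i}"
    using set_play[of _ i \<sigma> \<chi> k] k(1) by blast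
  with i(2) have "contains_copy ({..<n}, {e \<in> snd (complete_graph n). \<chi> e = i}) (G i)"
    by (rule contains_copy_mono)
  then show ?thesis using i(1) by (rule bexI)
qed

text \<open>As a least number, \<open>ramsey_number\<close> only has the arrowing property if some number has it at all. The
  strategy itself shows this, since a winning play exposes a copy in the coloring.\<close>

lemma ramsey_number_matchings_gt:
  fixes r :: "nat \<Rightarrow> nat"
  assumes t: "2 \<le> t" and pos: "\<And>i. i \<in> {1..t} \<Longrightarrow> r i > 0" and j: "j \<in> {1..t}"
  shows "(\<Sum>i=1..t. r i - 1) + r j < ramsey_number t (\<lambda>i. matching_graph (r i))"
proof -
  define arrows where "arrows n \<longleftrightarrow> (\<forall>\<chi>\<in>edge_colorings t n. \<exists>i\<in>{1..t}.
        contains_copy ({..<n}, {e \<in> snd (complete_graph n). \<chi> e = i}) (matching_graph (r i)))" for n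
  let ?N = "Suc ((\<Sum>i=1..t. r i - 1) + (\<Sum>i=1..t. r i))"
  have "(\<Sum>i=1..t. r i - 1) + r i < ?N" if "i \<in> {1..t}" for i
    using member_le_sum[of i "{1..t}" r] that by simp
  from winning_strategy_exists[OF t pos this]
  obtain \<sigma> l where \<sigma>: "winning_strategy t (\<lambda>i. matching_graph (r i)) ?N l \<sigma>" by blast
  have "arrows ?N"
    unfolding arrows_def by (intro ballI winning_strategy_forces_copy[OF \<sigma>])
  then have "arrows (LEAST n. arrows n)" by (rule LeastI)
  then have R: "arrows (ramsey_number t (\<lambda>i. matching_graph (r i)))"
    by (simp add: arrows_def ramsey_number_def)
  show ?thesis
  proof (rule ccontr)
    assume "\<not> ?thesis"
    then have "ramsey_number t (\<lambda>i. matching_graph (r i)) \<le> (\<Sum>i=1..t. r i - 1) + r j" by simp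
    from matching_avoiding_coloring[OF j pos this] R show False
      unfolding arrows_def by blast
  qed
qed

theorem theorem1:
  fixes t n :: nat and r :: "nat \<Rightarrow> nat"
  assumes "t \<ge> 2"
    and "\<And>i. i \<in> {1..t} \<Longrightarrow> r i > 0"
    and "n \<ge> ramsey_number t (\<lambda>i. matching_graph (r i))"
  shows "real (restricted_online_ramsey t (\<lambda>i. matching_graph (r i)) n)
    \<le> (2 * real t - 1 + (real t - 3) * lg (real t - 2)) / (real t + 1) * real n"
proof -
  have "(\<Sum>i=1..t. r i - 1) + r j < n" if "j \<in> {1..t}" for j
    using ramsey_number_matchings_gt[of t r j, OF assms(1,2) that] assms(3) by linarith
  from winning_strategy_exists[of t r n, OF assms(1,2) this]
  have "restricted_online_ramsey t (\<lambda>i. matching_graph (r i)) n \<le> nat \<lfloor>rate t * real n\<rfloor>"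
    unfolding restricted_online_ramsey_def by (rule Least_le)
  moreover have "1 \<le> rate t" using rate_mono[of 2 t] rate_2 assms(1) by simp
  then have "0 \<le> rate t * real n" by simp
  then have "real (nat \<lfloor>rate t * real n\<rfloor>) \<le> rate t * real n" by simp
  ultimately have "real (restricted_online_ramsey t (\<lambda>i. matching_graph (r i)) n) \<le> rate t * real n"
    by linarith
  then show ?thesis by (simp add: rate_def single_step_bound_def)
qed

end
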